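(* Let $n$ be even and consider the cycle $C_n$. Run asynchronous discordant voting starting from any initial colouring with exactly $n/2$ red and $n/2$ blue vertices, and let $T$ be the time to consensus. Then for each of the Push, Pull and Oblivious protocols, $\mathbf{E}\,T=\Theta(n^2)$.
   Context: Discordant voting on a graph $G=(V,E)$: each vertex holds colour red or blue. An edge is discordant if its endpoints have different colours; a vertex is discordant if it is incident to a discordant edge; $D(X)$ is the set of discordant vertices of configuration $X$. Push rule: choose $v\in D(X_t)$ uniformly at random and a discordant neighbour $u$ of $v$ uniformly at random; $u$ adopts the colour of $v$. Pull rule: same choice, but $v$ adopts the colour of $u$. Oblivious rule: choose a discordant edge $\{u,v\}$ uniformly at random; with probability $1/2$ $v$ adopts $u$'s colour, otherwise $u$ adopts $v$'s colour. All other vertices keep their colours. $T$ is the first time at which all vertices have the same colour. *)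

theory Defs
  imports "HOL-Probability.Probability"
begin

datatype colour = Red | Blue

datatype protocol = Push | Pull | Oblivious

text \<open>A finite simple graph is given by its vertex set \<open>V\<close> and its set \<open>E\<close> of two-element edges.
  A configuration colours the whole vertex type; colours outside \<open>V\<close> are irrelevant and never
  change.\<close>

definition discordant_edges :: "'v set set \<Rightarrow> ('v \<Rightarrow> colour) \<Rightarrow> 'v set set" where
  "discordant_edges E X = {e \<in> E. \<exists>u v. e = {u, v} \<and> X u \<noteq> X v}"

definition discordant_vertices :: "'v set set \<Rightarrow> ('v \<Rightarrow> colour) \<Rightarrow> 'v set" where
  "discordant_vertices E X = {v. \<exists>e \<in> discordant_edges E X. v \<in> e}"

definition discordant_neighbours :: "'v set set \<Rightarrow> ('v \<Rightarrow> colour) \<Rightarrow> 'v \<Rightarrow> 'v set" where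
  "discordant_neighbours E X v = {u. {u, v} \<in> E \<and> X u \<noteq> X v}"

text \<open>One update of a configuration that has at least one discordant edge. For the oblivious rule,
  the endpoint \<open>w\<close> whose colour survives is uniform on the chosen edge \<open>e\<close>, so each of the two
  endpoints prevails with probability 1/2; giving all of \<open>e\<close> the colour of \<open>w\<close> recolours exactly
  the other endpoint.\<close>

fun update :: "protocol \<Rightarrow> 'v set set \<Rightarrow> ('v \<Rightarrow> colour) \<Rightarrow> ('v \<Rightarrow> colour) pmf" where
  "update Push E X =
     bind_pmf (pmf_of_set (discordant_vertices E X)) (\<lambda>v.
       map_pmf (\<lambda>u. X(u := X v)) (pmf_of_set (discordant_neighbours E X v)))"
| "update Pull E X =
     bind_pmf (pmf_of_set (discordant_vertices E X)) (\<lambda>v.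
       map_pmf (\<lambda>u. X(v := X u)) (pmf_of_set (discordant_neighbours E X v)))"
| "update Oblivious E X =
     bind_pmf (pmf_of_set (discordant_edges E X)) (\<lambda>e.
       map_pmf (\<lambda>w. (\<lambda>x. if x \<in> e then X w else X x)) (pmf_of_set e))"

text \<open>Configurations without discordant edges are absorbing (\<open>pmf_of_set\<close> is unspecified on the
  empty set).\<close>

definition voting_kernel :: "protocol \<Rightarrow> 'v set set \<Rightarrow> ('v \<Rightarrow> colour) \<Rightarrow> ('v \<Rightarrow> colour) pmf" where
  "voting_kernel p E X = (if discordant_edges E X = {} then return_pmf X else update p E X)"

text \<open>The law on trajectories \<open>nat \<Rightarrow> 's\<close> of the time-homogeneous Markov chain with transition
  kernel \<open>K\<close> started in \<open>x\<^sub>0\<close>, obtained from the Ionescu-Tulcea theorem. The lemma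
  \<open>emeasure_markov_chain_cylinder\<close> below gives its finite-dimensional distributions.\<close>

definition chain_step :: "('s \<Rightarrow> 's pmf) \<Rightarrow> 's \<Rightarrow> nat \<Rightarrow> (nat \<Rightarrow> 's) \<Rightarrow> 's measure" where
  "chain_step K x\<^sub>0 t \<omega> =
     measure_pmf (case t of 0 \<Rightarrow> return_pmf x\<^sub>0 | Suc s \<Rightarrow> K (\<omega> s))"

definition markov_chain :: "('s \<Rightarrow> 's pmf) \<Rightarrow> 's \<Rightarrow> (nat \<Rightarrow> 's) measure" where
  "markov_chain K x\<^sub>0 =
     projective_family.lim UNIV
       (Ionescu_Tulcea.CI (chain_step K x\<^sub>0) (\<lambda>_. count_space UNIV)) (\<lambda>_. count_space UNIV)"

definition consensus :: "'v set \<Rightarrow> ('v \<Rightarrow> colour) \<Rightarrow> bool" where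
  "consensus V X \<longleftrightarrow> (\<forall>u\<in>V. \<forall>v\<in>V. X u = X v)"

text \<open>The first time of consensus along a trajectory, which is \<open>\<infinity>\<close> if there is none.\<close>

definition consensus_time :: "'v set \<Rightarrow> (nat \<Rightarrow> 'v \<Rightarrow> colour) \<Rightarrow> enat" where
  "consensus_time V \<omega> = (INF t\<in>{t. consensus V (\<omega> t)}. enat t)"

definition expected_consensus_time ::
    "protocol \<Rightarrow> 'v set \<Rightarrow> 'v set set \<Rightarrow> ('v \<Rightarrow> colour) \<Rightarrow> ennreal" where
  "expected_consensus_time p V E X\<^sub>0 =
     (\<integral>\<^sup>+\<omega>. ennreal_of_enat (consensus_time V \<omega>) \<partial>markov_chain (voting_kernel p E) X\<^sub>0)"

text \<open>The cycle \<open>C\<^sub>n\<close>, a simple graph for \<open>n \<ge> 3\<close>.\<close>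

definition cycle_verts :: "nat \<Rightarrow> nat set" where
  "cycle_verts n = {0..<n}"

definition cycle_edges :: "nat \<Rightarrow> nat set set" where
  "cycle_edges n = (\<lambda>i. {i, Suc i mod n}) ` {0..<n}"

lemma Ionescu_Tulcea_chain_step:
  "Ionescu_Tulcea (chain_step K x\<^sub>0) (\<lambda>_. count_space UNIV)"
proof (rule Ionescu_Tulcea.intro)
  show "chain_step K x\<^sub>0 t \<in> measurable (PiM {0..<t} (\<lambda>_. count_space UNIV))
          (subprob_algebra (count_space UNIV))" for t
  proof (cases t)
    case 0
    then show ?thesis
      by (simp add: chain_step_def[abs_def] measure_pmf_in_subprob_algebra)
  next
    case (Suc s)
    have "(\<lambda>\<omega>. measure_pmf (K (\<omega> s))) \<in> measurable (PiM {0..<t} (\<lambda>_. count_space UNIV))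
            (subprob_algebra (count_space UNIV))"
      by (rule measurable_compose[OF measurable_component_singleton])
        (auto simp: Suc measure_pmf_in_subprob_algebra)
    then show ?thesis
      by (simp add: chain_step_def[abs_def] Suc)
  qed
  show "prob_space (chain_step K x\<^sub>0 t \<omega>)" for t \<omega>
    by (simp add: chain_step_def measure_pmf.prob_space_axioms)
qed

lemma sets_markov_chain [simp, measurable_cong]:
  "sets (markov_chain K x\<^sub>0) = sets (PiM UNIV (\<lambda>_. count_space UNIV))"
proof -
  interpret Ionescu_Tulcea "chain_step K x\<^sub>0" "\<lambda>_. count_space UNIV"
    by (rule Ionescu_Tulcea_chain_step)
  show ?thesis by (simp add: markov_chain_def)
qed

lemma emeasure_markov_chain_cylinder:
  "emeasure (markov_chain K x\<^sub>0) {\<omega>. \<forall>i\<le>t. \<omega> i = x i} =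
     ennreal (indicator {x\<^sub>0} (x 0) * (\<Prod>i<t. pmf (K (x i)) (x (Suc i))))"
proof -
  interpret IT: Ionescu_Tulcea "chain_step K x\<^sub>0" "\<lambda>_. count_space UNIV"
    by (rule Ionescu_Tulcea_chain_step)
  let ?M = "\<lambda>_::nat. count_space (UNIV :: 'a set)"
  define S where "S n = PiE {0..<n} (\<lambda>i. {x i})" for n
  have S_sets [measurable]: "S n \<in> sets (PiM {0..<n} ?M)" for n
    unfolding S_def by (rule sets_PiM_I_finite) auto
  have S_eq: "S n = {restrict x {0..<n}}" for n
    by (auto simp: S_def PiE_iff extensional_def restrict_def fun_eq_iff)
  have step: "emeasure (IT.C 0 (Suc n) (\<lambda>_. undefined)) (S (Suc n)) =
      emeasure (IT.C 0 n (\<lambda>_. undefined)) (S n) * emeasure (chain_step K x\<^sub>0 n x) {x n}" for n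
  proof -
    have sp: "(\<lambda>_. undefined) \<in> space (PiM {0..<0} ?M)" by (simp add: space_PiM)
    have sets_C: "sets (IT.C 0 n (\<lambda>_. undefined)) = sets (PiM {0..<n} ?M)"
      using IT.sets_C[OF sp, of n] by simp
    have ep: "emeasure (IT.eP n \<omega>) (S (Suc n)) =
        emeasure (chain_step K x\<^sub>0 n x) {x n} * indicator (S n) \<omega>"
      if w: "\<omega> \<in> space (PiM {0..<n} ?M)" for \<omega>
    proof -
      have ext: "\<omega> \<in> extensional {0..<n}"
        using w by (auto simp: space_PiM PiE_def)
      have upd: "fun_upd \<omega> n y \<in> S (Suc n) \<longleftrightarrow> \<omega> \<in> S n \<and> y = x n" for y
        using ext by (auto simp: S_def PiE_iff extensional_def less_Suc_eq)
      have "chain_step K x\<^sub>0 n \<omega> = chain_step K x\<^sub>0 n x" if "\<omega> \<in> S n"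
        using that by (auto simp: chain_step_def S_def PiE_iff split: nat.split)
      moreover have "fun_upd \<omega> n -` S (Suc n) = (if \<omega> \<in> S n then {x n} else {})"
        using upd by auto
      ultimately show ?thesis
        using w by (subst IT.emeasure_eP) auto
    qed
    have "emeasure (IT.C 0 (Suc n) (\<lambda>_. undefined)) (S (Suc n)) =
        (\<integral>\<^sup>+\<omega>. emeasure (IT.eP n \<omega>) (S (Suc n)) \<partial>IT.C 0 n (\<lambda>_. undefined))"
      using IT.measurable_eP[of n] S_sets[of "Suc n"] sets_eq_imp_space_eq[OF sets_C]
      by (simp, subst emeasure_bind[where N = "PiM {0..<Suc n} ?M"])
        (auto simp: sets_C cong: measurable_cong_sets)
    also have "\<dots> = (\<integral>\<^sup>+\<omega>. emeasure (chain_step K x\<^sub>0 n x) {x n} * indicator (S n) \<omega>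
        \<partial>IT.C 0 n (\<lambda>_. undefined))"
      using sets_eq_imp_space_eq[OF sets_C] by (intro nn_integral_cong ep) auto
    finally show ?thesis
      using S_sets[of n] by (simp add: sets_C nn_integral_cmult_indicator del: IT.C.simps)
        (simp add: mult.commute)
  qed
  have "emeasure (IT.C 0 (Suc t) (\<lambda>_. undefined)) (S (Suc t)) =
     ennreal (indicator {x\<^sub>0} (x 0) * (\<Prod>i<t. pmf (K (x i)) (x (Suc i))))"
  proof (induction t)
    case 0
    show ?case
      unfolding step
      by (auto simp: S_eq chain_step_def emeasure_pmf_single restrict_def indicator_def
          PiM_empty pmf_return space_PiM)
  next
    case (Suc t)
    show ?case
      unfolding step[of "Suc t"] Suc
      by (simp add: chain_step_def emeasure_pmf_single ennreal_mult''[symmetric] mult.assoc)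
  qed
  moreover have "{\<omega>. \<forall>i\<le>t. \<omega> i = x i} = prod_emb UNIV ?M {0..<Suc t} (S (Suc t))"
    by (auto simp: prod_emb_def S_def PiE_iff space_PiM less_Suc_eq_le)
  ultimately show ?thesis
    unfolding markov_chain_def
    by (simp only: IT.lim[OF finite_atLeastLessThan S_sets])
      (subst IT.emeasure_CI[of _ "Suc t"], auto simp: prod_emb_id S_def)
qed

lemma borel_measurable_consensus_time [measurable]:
  "(\<lambda>\<omega>. ennreal_of_enat (consensus_time V \<omega>)) \<in> borel_measurable (markov_chain K x\<^sub>0)"
proof -
  have [measurable]: "Measurable.pred (PiM UNIV (\<lambda>_. count_space UNIV)) (\<lambda>\<omega>. consensus V (\<omega> t))"
    for t :: nat
    by (rule measurable_compose[OF measurable_component_singleton]) auto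
  have eq: "consensus_time V =
      (\<lambda>\<omega>. INF t. if consensus V (\<omega> t) then enat t else \<infinity>)"
    unfolding consensus_time_def
    by (intro ext antisym INF_greatest)
      (auto intro: INF_lower Inf_lower simp flip: top_enat_def)
  have "consensus_time V \<in> measurable (PiM UNIV (\<lambda>_. count_space UNIV)) (count_space UNIV)"
    unfolding eq by measurable
  then have "(\<lambda>\<omega>. ennreal_of_enat (consensus_time V \<omega>)) \<in>
      borel_measurable (PiM UNIV (\<lambda>_. count_space UNIV))"
    by (rule measurable_compose) simp
  then show ?thesis
    by (simp cong: measurable_cong_sets)
qed

end

theory Submission
  imports Defs
begin

text \<open>Let \<open>R\<close> be the number of red vertices, \<open>D = 2 R - n\<close>, \<open>M\<close> the number of discordant edges, and
  \<open>s\<^sub>r\<close>, \<open>s\<^sub>b\<close> the numbers of isolated red and blue vertices (both neighbours have the other colour).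
  A step changes \<open>D\<close> by \<open>2\<close> in absolute value, and it lowers \<open>M\<close> by \<open>2\<close> if it flips an isolated
  vertex and leaves \<open>M\<close> unchanged otherwise. Under each of the three rules there is some \<open>q \<ge> 0\<close> such
  that \<open>D\<close> has drift at most \<open>2 q \<bar>s\<^sub>r - s\<^sub>b\<bar>\<close> in absolute value, while an isolated vertex is flipped
  with probability at least \<open>q (s\<^sub>r + s\<^sub>b)\<close>. So a multiple of \<open>M\<close> compensates the drift of any
  Lipschitz function of \<open>D\<close>.

  Upper bound: \<open>n\<^sup>2 - D\<^sup>2 + 2 n M\<close> decreases by at least \<open>4\<close> per step in expectation.

  Lower bound: replace \<open>D\<^sup>2\<close> by the Huber function \<open>H\<close> of \<open>D\<close> with threshold \<open>m = n / 8\<close>, and use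
  \<open>H + 2 m min M (M / 2 + 3 m)\<close>, which increases by at most \<open>4\<close> per step. The smaller slope for
  \<open>M > 6 m\<close> suffices because then isolated vertices abound in both colours, in ratio at most \<open>3\<close>;
  it keeps the initial value at most \<open>14 m\<^sup>2\<close>, whereas the value at consensus is at least \<open>15 m\<^sup>2\<close>.\<close>

section \<open>Drift bounds for hitting times of absorbing sets\<close>

text \<open>The projective limit has the finite-stage measure \<open>C 0 n\<close> as its marginal
  on the first \<open>n\<close> coordinates. At a finite stage the last step is an explicit bind, so
  its kernel can be integrated out.\<close>

lemma nn_integral_markov_chain_prefix:
  fixes h :: "(nat \<Rightarrow> 's) \<Rightarrow> ennreal"
  assumes h [measurable]: "h \<in> borel_measurable (PiM {0..<n} (\<lambda>_. count_space UNIV))"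
  shows "(\<integral>\<^sup>+\<omega>. h (restrict \<omega> {0..<n}) \<partial>markov_chain K x\<^sub>0) =
    (\<integral>\<^sup>+\<omega>. h \<omega> \<partial>Ionescu_Tulcea.C (chain_step K x\<^sub>0) (\<lambda>_. count_space UNIV) 0 n (\<lambda>_. undefined))"
proof -
  interpret IT: Ionescu_Tulcea "chain_step K x\<^sub>0" "\<lambda>_. count_space UNIV"
    by (rule Ionescu_Tulcea_chain_step)
  have sp: "(\<lambda>_. undefined) \<in> space (PiM {0..<0} (\<lambda>_::nat. count_space (UNIV :: 's set)))"
    by (simp add: space_PiM)
  have up: "IT.up_to {0..<n} = n"
    using IT.up_to[of "{0..<n}"] by (intro antisym) (auto simp: IT.up_to_iff_Ico)
  have "(\<integral>\<^sup>+\<omega>. h (restrict \<omega> {0..<n}) \<partial>markov_chain K x\<^sub>0) =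
      (\<integral>\<^sup>+\<omega>. h \<omega> \<partial>distr (markov_chain K x\<^sub>0) (PiM {0..<n} (\<lambda>_. count_space UNIV)) (\<lambda>\<omega>. restrict \<omega> {0..<n}))"
    by (subst nn_integral_distr)
      (auto intro!: measurable_restrict measurable_component_singleton
        simp: measurable_cong_sets[OF sets_markov_chain refl])
  also have "\<dots> = (\<integral>\<^sup>+\<omega>. h \<omega> \<partial>IT.CI {0..<n})"
    by (simp add: markov_chain_def IT.distr_lim)
  also have "IT.CI {0..<n} = IT.C 0 n (\<lambda>_. undefined)"
    unfolding IT.CI_def up using IT.distr_C[OF order_refl sp, of n] by simp
  finally show ?thesis .
qed

text \<open>The Markov property at one time: the last stage extends the previous one by a draw from
  \<open>K (\<omega> t)\<close>. With \<open>f = 1\<close> it gives a recursion for the expectation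
  of \<open>g\<close>; an indicator as \<open>f\<close> restricts to the present state.\<close>

lemma nn_integral_markov_chain_Suc:
  "(\<integral>\<^sup>+\<omega>. f (\<omega> t) * g (\<omega> (Suc t)) \<partial>markov_chain K x\<^sub>0) =
   (\<integral>\<^sup>+\<omega>. f (\<omega> t) * (\<integral>\<^sup>+y. g y \<partial>K (\<omega> t)) \<partial>markov_chain K x\<^sub>0)"
proof -
  interpret IT: Ionescu_Tulcea "chain_step K x\<^sub>0" "\<lambda>_. count_space UNIV"
    by (rule Ionescu_Tulcea_chain_step)
  let ?P = "\<lambda>n. PiM {0..<n} (\<lambda>_::nat. count_space (UNIV :: 'a set))"
  let ?C = "\<lambda>n. IT.C 0 n (\<lambda>_. undefined)"
  have sp: "(\<lambda>_. undefined) \<in> space (?P 0)"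
    by (simp add: space_PiM)
  have coord [measurable]: "(\<lambda>\<omega>. u (\<omega> i)) \<in> borel_measurable (?P n)" if "i < n"
    for i n and u :: "'a \<Rightarrow> ennreal"
    by (rule measurable_compose[OF measurable_component_singleton]) (use that in auto)
  have space_C: "space (?C (Suc t)) = space (?P (Suc t))"
    using IT.space_C[OF sp, of "Suc t"] by (simp del: IT.C.simps)
  have eP: "IT.eP (Suc t) \<in> measurable (?C (Suc t)) (subprob_algebra (?P (Suc (Suc t))))"
    by (subst measurable_cong_sets[OF IT.sets_C[OF sp] refl])
      (use IT.measurable_eP[of "Suc t"] in simp)
  let ?h = "\<lambda>\<omega>. f (\<omega> t) * g (\<omega> (Suc t))"
  have h [measurable]: "?h \<in> borel_measurable (?P (Suc (Suc t)))"
    by measurable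
  have "(\<integral>\<^sup>+\<omega>. ?h \<omega> \<partial>markov_chain K x\<^sub>0) = (\<integral>\<^sup>+\<omega>. ?h \<omega> \<partial>?C (Suc (Suc t)))"
    using nn_integral_markov_chain_prefix[OF h] by (simp del: IT.C.simps)
  also have "\<dots> = (\<integral>\<^sup>+\<omega>. (\<integral>\<^sup>+\<omega>'. ?h \<omega>' \<partial>IT.eP (Suc t) \<omega>) \<partial>?C (Suc t))"
    unfolding IT.C.simps(2)[of 0 "Suc t"] add_0
    by (rule nn_integral_bind[OF h]) (use eP in simp)
  also have "\<dots> = (\<integral>\<^sup>+\<omega>. f (\<omega> t) * (\<integral>\<^sup>+y. g y \<partial>K (\<omega> t)) \<partial>?C (Suc t))"
  proof (rule nn_integral_cong)
    fix \<omega> assume "\<omega> \<in> space (?C (Suc t))"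
    then have w: "\<omega> \<in> space (?P (Suc t))"
      unfolding space_C .
    show "(\<integral>\<^sup>+\<omega>'. ?h \<omega>' \<partial>IT.eP (Suc t) \<omega>) = f (\<omega> t) * (\<integral>\<^sup>+y. g y \<partial>K (\<omega> t))"
      by (subst IT.nn_integral_eP[OF w h]) (simp add: chain_step_def nn_integral_cmult)
  qed
  also have "\<dots> = (\<integral>\<^sup>+\<omega>. f (\<omega> t) * (\<integral>\<^sup>+y. g y \<partial>K (\<omega> t)) \<partial>markov_chain K x\<^sub>0)"
    using nn_integral_markov_chain_prefix[OF
        coord[of t "Suc t" "\<lambda>x. f x * (\<integral>\<^sup>+y. g y \<partial>K x)"], of K x\<^sub>0]
    by (simp del: IT.C.simps)
  finally show ?thesis .
qed

lemma nn_integral_markov_chain_0: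
  "(\<integral>\<^sup>+\<omega>. f (\<omega> 0) \<partial>markov_chain K x\<^sub>0) = f x\<^sub>0"
proof -
  interpret IT: Ionescu_Tulcea "chain_step K x\<^sub>0" "\<lambda>_. count_space UNIV"
    by (rule Ionescu_Tulcea_chain_step)
  let ?P = "\<lambda>n. PiM {0..<n} (\<lambda>_::nat. count_space (UNIV :: 'a set))"
  have w: "(\<lambda>_. undefined) \<in> space (?P 0)"
    by (simp add: space_PiM)
  have h [measurable]: "(\<lambda>\<omega>. f (\<omega> 0)) \<in> borel_measurable (?P (Suc 0))"
    by (rule measurable_compose[OF measurable_component_singleton]) auto
  have "(\<integral>\<^sup>+\<omega>. f (\<omega> 0) \<partial>markov_chain K x\<^sub>0) =
      (\<integral>\<^sup>+\<omega>. f (\<omega> 0) \<partial>IT.C 0 (Suc 0) (\<lambda>_. undefined))"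
    using nn_integral_markov_chain_prefix[OF h] by (simp del: IT.C.simps)
  also have "\<dots> = (\<integral>\<^sup>+\<omega>. f (\<omega> 0) \<partial>IT.eP 0 (\<lambda>_. undefined))"
    using bind_return[OF IT.measurable_eP[of 0] w] by simp
  also have "\<dots> = f x\<^sub>0"
    by (subst IT.nn_integral_eP[OF w h]) (simp add: chain_step_def)
  finally show ?thesis .
qed

lemma borel_measurable_markov_chain_coord [measurable]:
  fixes u :: "'s \<Rightarrow> ennreal"
  shows "(\<lambda>\<omega>. u (\<omega> t)) \<in> borel_measurable (markov_chain K x\<^sub>0)"
proof -
  have "(\<lambda>\<omega>. u (\<omega> t)) \<in> borel_measurable (PiM UNIV (\<lambda>_. count_space UNIV))"
    by (rule measurable_compose[OF measurable_component_singleton]) auto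
  then show ?thesis
    by (simp cong: measurable_cong_sets)
qed

lemma prob_space_markov_chain: "prob_space (markov_chain K x\<^sub>0)"
  by standard (use nn_integral_markov_chain_0[of K x\<^sub>0 "\<lambda>_. 1"] in simp)

context
  fixes K :: "'s \<Rightarrow> 's pmf" and A :: "'s set" and x\<^sub>0 :: 's
  assumes absorbing: "\<And>x. x \<in> A \<Longrightarrow> K x = return_pmf x"
begin

text \<open>For an absorbing \<open>A\<close> this is the tail probability P(T > t) of the hitting
  time T of \<open>A\<close>.\<close>

abbreviation (input) "alive t \<equiv> (\<integral>\<^sup>+\<omega>. indicator (- A) (\<omega> t) \<partial>markov_chain K x\<^sub>0)"

text \<open>For fixed \<open>t\<close> the Markov property gives the event of leaving
  \<open>A\<close> at that time probability 0, because \<open>K\<close> is a point mass on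
  \<open>A\<close>. There are countably many times.\<close>

lemma AE_markov_chain_absorbed:
  "AE \<omega> in markov_chain K x\<^sub>0. \<forall>t. \<omega> t \<in> A \<longrightarrow> \<omega> (Suc t) \<in> A"
proof (rule iffD2[OF AE_all_countable], rule allI)
  fix t
  have "(\<integral>\<^sup>+\<omega>. indicator A (\<omega> t) * indicator (- A) (\<omega> (Suc t)) \<partial>markov_chain K x\<^sub>0) =
      (\<integral>\<^sup>+\<omega>. indicator A (\<omega> t) * (\<integral>\<^sup>+y. indicator (- A) y \<partial>K (\<omega> t)) \<partial>markov_chain K x\<^sub>0)"
    by (rule nn_integral_markov_chain_Suc)
  also have "\<dots> = (\<integral>\<^sup>+\<omega>. 0 \<partial>markov_chain K x\<^sub>0)"
    by (intro nn_integral_cong) (auto simp: absorbing indicator_def)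
  finally have "(\<integral>\<^sup>+\<omega>. indicator A (\<omega> t) * indicator (- A) (\<omega> (Suc t)) \<partial>markov_chain K x\<^sub>0) = 0"
    by simp
  then have "AE \<omega> in markov_chain K x\<^sub>0. indicator A (\<omega> t) * indicator (- A) (\<omega> (Suc t)) = (0 :: ennreal)"
    by (subst (asm) nn_integral_0_iff_AE)
      (auto intro!: borel_measurable_times borel_measurable_markov_chain_coord)
  then show "AE \<omega> in markov_chain K x\<^sub>0. \<omega> t \<in> A \<longrightarrow> \<omega> (Suc t) \<in> A"
    by (rule AE_mp) (auto simp: indicator_def split: if_splits)
qed

text \<open>On a trajectory that never leaves \<open>A\<close>, the hitting time counts the times
  spent outside \<open>A\<close>. Exchanging sum and integral gives the tail-sum formula.\<close>

lemma expected_hitting_time_eq_suminf: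
  "(\<integral>\<^sup>+\<omega>. ennreal_of_enat (INF t\<in>{t. \<omega> t \<in> A}. enat t) \<partial>markov_chain K x\<^sub>0) = (\<Sum>t. alive t)"
proof -
  have "AE \<omega> in markov_chain K x\<^sub>0.
      ennreal_of_enat (INF t\<in>{t. \<omega> t \<in> A}. enat t) = (\<Sum>t. indicator (- A) (\<omega> t))"
    using AE_markov_chain_absorbed
  proof (rule AE_mp, intro AE_I2 impI)
    fix \<omega> :: "nat \<Rightarrow> 's" assume abs: "\<forall>t. \<omega> t \<in> A \<longrightarrow> \<omega> (Suc t) \<in> A"
    show "ennreal_of_enat (INF t\<in>{t. \<omega> t \<in> A}. enat t) = (\<Sum>t. indicator (- A) (\<omega> t))"
    proof (cases "\<exists>t. \<omega> t \<in> A")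
      case True
      define k where "k = (LEAST t. \<omega> t \<in> A)"
      have k: "\<omega> k \<in> A" "\<And>t. \<omega> t \<in> A \<Longrightarrow> k \<le> t"
        using True by (auto simp: k_def intro: LeastI Least_le)
      have "\<omega> t \<in> A" if "k \<le> t" for t
        using that by (induction rule: dec_induct) (use k abs in auto)
      with k have iff: "\<omega> t \<in> A \<longleftrightarrow> k \<le> t" for t
        by blast
      have "(INF t\<in>{t. \<omega> t \<in> A}. enat t) = enat k"
        using k by (intro antisym INF_greatest INF_lower2[of k]) auto
      moreover have "(\<Sum>t. indicator (- A) (\<omega> t) :: ennreal) = (\<Sum>t<k. 1)"
        by (subst suminf_finite[of "{..<k}"]) (auto simp: iff indicator_def)
      ultimately show ?thesis
        by (simp add: ennreal_of_nat_eq_real_of_nat)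
    next
      case False
      \<comment> \<open>Without a visit to \<open>A\<close> the hitting time is the infimum of the
        empty set, which is \<infinity>, so the series of ones has to diverge.\<close>
      have "(\<Sum>t. 1 :: ennreal) = top"
      proof (rule ccontr)
        assume "(\<Sum>t. 1 :: ennreal) \<noteq> top"
        then obtain n :: nat where n: "(\<Sum>t. 1 :: ennreal) < of_nat n"
          using ennreal_Ex_less_of_nat less_top by blast
        have "(\<Sum>t<n. 1 :: ennreal) \<le> (\<Sum>t. 1 :: ennreal)"
          by (rule sum_le_suminf) auto
        with n show False
          by (simp add: leD)
      qed
      with False show ?thesis
        by (simp add: indicator_def top_enat_def)
    qed
  qed
  then have "(\<integral>\<^sup>+\<omega>. ennreal_of_enat (INF t\<in>{t. \<omega> t \<in> A}. enat t) \<partial>markov_chain K x\<^sub>0) =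
      (\<integral>\<^sup>+\<omega>. (\<Sum>t. indicator (- A) (\<omega> t)) \<partial>markov_chain K x\<^sub>0)"
    by (rule nn_integral_cong_AE)
  then show ?thesis
    by (simp add: nn_integral_suminf)
qed

text \<open>Additive drift: each step costs \<open>c\<close> in expectation as long as the chain is
  outside \<open>A\<close>, and \<open>g\<close> is preserved on \<open>A\<close>. Telescoping
  bounds the total cost by the initial value.\<close>

lemma suminf_alive_le:
  fixes g :: "'s \<Rightarrow> ennreal"
  assumes drift: "\<And>x. x \<notin> A \<Longrightarrow> (\<integral>\<^sup>+y. g y \<partial>K x) + c \<le> g x"
  shows "c * (\<Sum>t. alive t) \<le> g x\<^sub>0"
proof -
  let ?E = "\<lambda>t. \<integral>\<^sup>+\<omega>. g (\<omega> t) \<partial>markov_chain K x\<^sub>0"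
  have step: "?E (Suc t) + c * alive t \<le> ?E t" for t
  proof -
    have "?E (Suc t) + c * alive t =
        (\<integral>\<^sup>+\<omega>. (\<integral>\<^sup>+y. g y \<partial>K (\<omega> t)) + c * indicator (- A) (\<omega> t) \<partial>markov_chain K x\<^sub>0)"
      using nn_integral_markov_chain_Suc[of K x\<^sub>0 "\<lambda>_. 1" t g]
      by (simp add: nn_integral_add nn_integral_cmult)
    also have "\<dots> \<le> ?E t"
      using drift by (intro nn_integral_mono) (auto simp: indicator_def absorbing)
    finally show ?thesis .
  qed
  have bound: "?E t + c * (\<Sum>s<t. alive s) \<le> g x\<^sub>0" for t
  proof (induction t)
    case 0
    then show ?case by (simp add: nn_integral_markov_chain_0)
  next
    case (Suc t)
    have "?E (Suc t) + c * (\<Sum>s<Suc t. alive s) = (?E (Suc t) + c * alive t) + c * (\<Sum>s<t. alive s)"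
      by (simp add: distrib_left ac_simps)
    also have "\<dots> \<le> ?E t + c * (\<Sum>s<t. alive s)"
      by (intro add_right_mono step)
    finally show ?case
      using Suc by (rule order_trans)
  qed
  have "(\<Sum>s<t. c * alive s) \<le> g x\<^sub>0" for t
    unfolding sum_distrib_left[symmetric] by (rule order_trans[OF _ bound[of t]]) simp
  then have "(\<Sum>t. c * alive t) \<le> g x\<^sub>0"
    by (intro suminf_le_const summableI)
  then show ?thesis
    by simp
qed

text \<open>Additive drift in the other direction: the expectation of \<open>g\<close> grows by at
  most \<open>c\<close> times the tail probability per step, yet must reach \<open>b\<close> in the
  limit, because a finite expected hitting time forces absorption.\<close>

lemma suminf_alive_ge:
  fixes g :: "'s \<Rightarrow> ennreal" and b :: ennreal
  assumes drift: "\<And>x. x \<notin> A \<Longrightarrow> (\<integral>\<^sup>+y. g y \<partial>K x) \<le> g x + c"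
    and target: "\<And>x. x \<in> A \<Longrightarrow> b \<le> g x"
    and finite: "b \<noteq> top" "(\<Sum>t. alive t) \<noteq> top"
  shows "b \<le> g x\<^sub>0 + c * (\<Sum>t. alive t)"
proof -
  let ?E = "\<lambda>t. \<integral>\<^sup>+\<omega>. g (\<omega> t) \<partial>markov_chain K x\<^sub>0"
  interpret prob_space "markov_chain K x\<^sub>0"
    by (rule prob_space_markov_chain)
  have step: "?E (Suc t) \<le> ?E t + c * alive t" for t
  proof -
    have "?E (Suc t) = (\<integral>\<^sup>+\<omega>. (\<integral>\<^sup>+y. g y \<partial>K (\<omega> t)) \<partial>markov_chain K x\<^sub>0)"
      using nn_integral_markov_chain_Suc[of K x\<^sub>0 "\<lambda>_. 1" t g] by simp
    also have "\<dots> \<le> (\<integral>\<^sup>+\<omega>. g (\<omega> t) + c * indicator (- A) (\<omega> t) \<partial>markov_chain K x\<^sub>0)"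
      using drift by (intro nn_integral_mono) (auto simp: indicator_def absorbing)
    finally show ?thesis
      by (simp add: nn_integral_add nn_integral_cmult)
  qed
  have sum: "?E t \<le> g x\<^sub>0 + c * (\<Sum>s<t. alive s)" for t
  proof (induction t)
    case 0
    then show ?case by (simp add: nn_integral_markov_chain_0)
  next
    case (Suc t)
    have "?E (Suc t) \<le> (g x\<^sub>0 + c * (\<Sum>s<t. alive s)) + c * alive t"
      by (rule order_trans[OF step add_right_mono[OF Suc]])
    then show ?case
      by (simp add: distrib_left ac_simps)
  qed
  \<comment> \<open>At time \<open>t\<close> the value \<open>b\<close> is guaranteed only on the
    absorbed event. The missing mass \<open>b * alive t\<close> is added on the right instead of
    being subtracted on the left, since subtraction in \<open>ennreal\<close> truncates.\<close>
  have bound: "b \<le> g x\<^sub>0 + c * (\<Sum>t. alive t) + b * alive t" for t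
  proof -
    have "b = (\<integral>\<^sup>+\<omega>. b \<partial>markov_chain K x\<^sub>0)"
      by (simp add: emeasure_space_1)
    also have "\<dots> \<le> (\<integral>\<^sup>+\<omega>. g (\<omega> t) + b * indicator (- A) (\<omega> t) \<partial>markov_chain K x\<^sub>0)"
      using target by (intro nn_integral_mono) (auto simp: indicator_def)
    also have "\<dots> = ?E t + b * alive t"
      by (simp add: nn_integral_add nn_integral_cmult)
    also have "?E t \<le> g x\<^sub>0 + c * (\<Sum>t. alive t)"
      by (rule order_trans[OF sum]) (intro add_left_mono mult_left_mono sum_le_suminf, auto)
    finally show ?thesis
      by (simp add: add_right_mono)
  qed
  \<comment> \<open>The terms of a convergent series tend to 0; finiteness allows passing to real
    numbers.\<close>
  have "(\<lambda>t. alive t) \<longlonglongrightarrow> 0"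
  proof -
    have fin: "alive t \<noteq> top" for t
      using finite(2) sum_le_suminf[of "\<lambda>t. alive t" "{t}"] by (auto simp: top_unique)
    have "(\<lambda>t. ennreal (enn2real (alive t))) \<longlonglongrightarrow> ennreal 0"
    proof (intro tendsto_ennrealI summable_LIMSEQ_zero summable_suminf_not_top)
      show "(\<Sum>t. ennreal (enn2real (alive t))) \<noteq> top"
        using finite(2) fin by (simp add: ennreal_enn2real_if)
    qed auto
    then show ?thesis
      using fin by (simp add: ennreal_enn2real_if)
  qed
  then have "(\<lambda>t. g x\<^sub>0 + c * (\<Sum>t. alive t) + b * alive t) \<longlonglongrightarrow>
      g x\<^sub>0 + c * (\<Sum>t. alive t) + b * 0"
    by (intro tendsto_add tendsto_const ennreal_tendsto_cmult) (use finite(1) in \<open>auto simp: top.not_eq_extremum\<close>)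
  then show ?thesis
    using bound by (intro LIMSEQ_le_const[of _ _ b]) auto
qed

end

section \<open>Discordance in 2-regular graphs\<close>

fun opposite :: "colour \<Rightarrow> colour" where
  "opposite Red = Blue"
| "opposite Blue = Red"

lemma colour_neq_iff: "a \<noteq> b \<longleftrightarrow> a = opposite b" for a b :: colour
  by (cases a; cases b) auto

lemma opposite_neq [simp]: "opposite c \<noteq> c" "c \<noteq> opposite c"
  by (cases c; simp)+

text \<open>Each rule recolours exactly one vertex, which takes the other colour, so a step is
  determined by the vertex that changes.\<close>

abbreviation flip :: "('v \<Rightarrow> colour) \<Rightarrow> 'v \<Rightarrow> 'v \<Rightarrow> colour" where
  "flip X v \<equiv> X(v := opposite (X v))"

text \<open>Such graphs are disjoint unions of cycles. The counts of discordant edges and vertices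
  are local, so connectedness is added only when consensus is discussed.\<close>

locale two_regular_graph =
  fixes V :: "'v set" and E :: "'v set set"
  assumes finite_verts: "finite V"
    and edge_cases: "\<And>e. e \<in> E \<Longrightarrow> \<exists>u\<in>V. \<exists>v\<in>V. u \<noteq> v \<and> e = {u, v}"
    and two_neighbours: "\<And>v. v \<in> V \<Longrightarrow> card {u. {u, v} \<in> E} = 2"
begin

lemmas [simp] = finite_verts

definition discordant_degree :: "('v \<Rightarrow> colour) \<Rightarrow> 'v \<Rightarrow> nat" where
  "discordant_degree X v = card (discordant_neighbours E X v)"

definition colour_class :: "('v \<Rightarrow> colour) \<Rightarrow> colour \<Rightarrow> 'v set" where
  "colour_class X c = {v \<in> V. X v = c}"

definition isolated :: "('v \<Rightarrow> colour) \<Rightarrow> colour \<Rightarrow> 'v set" where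
  "isolated X c = {v \<in> V. X v = c \<and> discordant_degree X v = 2}"

lemma edge_endpoints: "{u, v} \<in> E \<Longrightarrow> u \<in> V \<and> v \<in> V \<and> u \<noteq> v"
  using edge_cases[of "{u, v}"] by (auto simp: doubleton_eq_iff)

lemma discordant_neighbours_subset: "discordant_neighbours E X v \<subseteq> V"
  by (auto simp: discordant_neighbours_def dest: edge_endpoints)

lemma finite_discordant_neighbours [simp]: "finite (discordant_neighbours E X v)"
  by (rule finite_subset[OF discordant_neighbours_subset finite_verts])

lemma finite_edges: "finite E"
  by (rule finite_subset[of _ "Pow V"]) (use finite_verts edge_cases in blast, simp add: finite_verts)

lemma finite_discordant_edges [simp]: "finite (discordant_edges E X)"
  by (rule finite_subset[OF _ finite_edges]) (auto simp: discordant_edges_def)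

lemma discordant_neighbours_sym:
  "u \<in> discordant_neighbours E X v \<longleftrightarrow> v \<in> discordant_neighbours E X u"
  by (auto simp: discordant_neighbours_def insert_commute)

lemma doubleton_discordant_iff:
  "{u, v} \<in> discordant_edges E X \<longleftrightarrow> u \<in> discordant_neighbours E X v"
proof -
  have "(\<exists>a b. {u, v} = {a, b} \<and> X a \<noteq> X b) \<longleftrightarrow> X u \<noteq> X v"
    by (auto simp: doubleton_eq_iff)
  then show ?thesis
    unfolding discordant_edges_def discordant_neighbours_def by simp
qed

text \<open>The endpoints of a discordant edge can be ordered so that the first one has any
  prescribed colour \<open>c\<close>.\<close>

lemma discordant_edge_cases:
  assumes "e \<in> discordant_edges E X"
  obtains u v where "e = {u, v}" "u \<in> discordant_neighbours E X v" "u \<in> V" "v \<in> V" "u \<noteq> v"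
    "X u = c" "X v = opposite c"
proof -
  obtain u v where uv: "e = {u, v}" "u \<noteq> v" "u \<in> V" "v \<in> V"
    using assms edge_cases[of e] by (auto simp: discordant_edges_def)
  then have d: "u \<in> discordant_neighbours E X v"
    using assms doubleton_discordant_iff[of u v X] by simp
  then have "X u = opposite (X v)"
    by (simp add: discordant_neighbours_def colour_neq_iff[of "X u"])
  then have "X u = c \<and> X v = opposite c \<or> X v = c \<and> X u = opposite c"
    by (cases c; cases "X v") auto
  then show thesis
  proof (elim disjE conjE)
    assume "X u = c" "X v = opposite c"
    then show thesis
      by (rule that[OF uv(1) d uv(3,4,2)])
  next
    assume "X v = c" "X u = opposite c"
    moreover have "e = {v, u}" "v \<in> discordant_neighbours E X u"
      using uv d discordant_neighbours_sym[of u X v] by auto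
    ultimately show thesis
      using uv by (intro that[of v u]) auto
  qed
qed

lemma discordant_vertices_iff:
  "v \<in> discordant_vertices E X \<longleftrightarrow> v \<in> V \<and> 1 \<le> discordant_degree X v"
proof -
  have "v \<in> discordant_vertices E X \<longleftrightarrow> discordant_neighbours E X v \<noteq> {}"
  proof
    assume "v \<in> discordant_vertices E X"
    then obtain e where e: "e \<in> discordant_edges E X" "v \<in> e"
      by (auto simp: discordant_vertices_def)
    from e(1) obtain a b where "e = {a, b}" "a \<in> discordant_neighbours E X b"
      by (rule discordant_edge_cases[where c = Red])
    then show "discordant_neighbours E X v \<noteq> {}"
      using e(2) discordant_neighbours_sym[of a X b] by auto
  next
    assume "discordant_neighbours E X v \<noteq> {}"
    then obtain u where "{u, v} \<in> discordant_edges E X"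
      by (auto simp: doubleton_discordant_iff)
    then show "v \<in> discordant_vertices E X"
      by (auto simp: discordant_vertices_def)
  qed
  also have "\<dots> \<longleftrightarrow> v \<in> V \<and> discordant_neighbours E X v \<noteq> {}"
    by (auto simp: discordant_neighbours_def dest: edge_endpoints)
  finally show ?thesis
    by (simp add: discordant_degree_def Suc_le_eq card_gt_0_iff)
qed

lemma finite_discordant_vertices [simp]: "finite (discordant_vertices E X)"
  by (rule finite_subset[OF _ finite_verts]) (auto simp: discordant_vertices_iff)

lemma discordant_degree_le: "v \<in> V \<Longrightarrow> discordant_degree X v \<le> 2"
  unfolding discordant_degree_def two_neighbours[symmetric]
  by (rule card_mono[OF finite_subset[OF _ finite_verts]])
    (auto simp: discordant_neighbours_def dest: edge_endpoints)

text \<open>Every discordant edge has exactly one endpoint of colour \<open>c\<close>, so it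
  corresponds to one pair of a vertex in that class and a discordant neighbour of it.\<close>

lemma card_discordant_edges:
  "card (discordant_edges E X) = (\<Sum>v\<in>colour_class X c. discordant_degree X v)"
proof -
  have "bij_betw (\<lambda>(v, u). {v, u}) (SIGMA v:colour_class X c. discordant_neighbours E X v)
      (discordant_edges E X)"
    unfolding bij_betw_def
  proof (intro conjI equalityI subsetI)
    show "inj_on (\<lambda>(v, u). {v, u}) (SIGMA v:colour_class X c. discordant_neighbours E X v)"
      by (auto simp: inj_on_def colour_class_def discordant_neighbours_def doubleton_eq_iff)
    fix e assume "e \<in> discordant_edges E X"
    then obtain u v where "e = {u, v}" "u \<in> discordant_neighbours E X v" "u \<in> V" "X u = c"
      by (rule discordant_edge_cases[where c = c])
    then show "e \<in> (\<lambda>(v, u). {v, u}) ` (SIGMA v:colour_class X c. discordant_neighbours E X v)"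
      using discordant_neighbours_sym[of u X v]
      by (intro image_eqI[of _ _ "(u, v)"]) (auto simp: colour_class_def)
  qed (auto simp: doubleton_discordant_iff intro: discordant_neighbours_sym[THEN iffD1])
  then have "card (discordant_edges E X) =
      card (SIGMA v:colour_class X c. discordant_neighbours E X v)"
    by (rule bij_betw_same_card[symmetric])
  also have "\<dots> = (\<Sum>v\<in>colour_class X c. discordant_degree X v)"
    unfolding discordant_degree_def
    by (rule card_SigmaI) (auto simp: colour_class_def finite_verts)
  finally show ?thesis .
qed

text \<open>A degree of at most 2 is the sum of the indicators of being at least 1 and of being 2.
  Hence the numbers of red and blue discordant vertices differ exactly by the numbers of isolated
  ones, which is the source of all drift.\<close>

lemma card_discordant_class:
  "card {v \<in> discordant_vertices E X. X v = c} + card (isolated X c) = card (discordant_edges E X)"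
proof -
  let ?C = "colour_class X c"
  have fin: "finite ?C"
    by (simp add: colour_class_def finite_verts)
  have "card (discordant_edges E X) = (\<Sum>v\<in>?C. discordant_degree X v)"
    by (rule card_discordant_edges)
  also have "\<dots> = (\<Sum>v\<in>?C. of_bool (1 \<le> discordant_degree X v) + of_bool (discordant_degree X v = 2))"
  proof (rule sum.cong[OF refl])
    fix v assume "v \<in> ?C"
    then have "discordant_degree X v \<le> 2"
      by (auto simp: colour_class_def intro: discordant_degree_le)
    then show "discordant_degree X v =
        of_bool (1 \<le> discordant_degree X v) + of_bool (discordant_degree X v = 2)"
      by (auto simp: of_bool_def)
  qed
  also have "\<dots> = card {v \<in> ?C. 1 \<le> discordant_degree X v} + card {v \<in> ?C. discordant_degree X v = 2}"
    by (simp add: sum.distrib sum.If_cases fin of_bool_def Int_def)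
  also have "{v \<in> ?C. 1 \<le> discordant_degree X v} = {v \<in> discordant_vertices E X. X v = c}"
    by (auto simp: colour_class_def discordant_vertices_iff)
  also have "{v \<in> ?C. discordant_degree X v = 2} = isolated X c"
    by (auto simp: colour_class_def isolated_def)
  finally show ?thesis ..
qed

lemma card_discordant_edges_le:
  "card (discordant_edges E X) \<le> card (colour_class X c) + card (isolated X c)"
proof -
  have "card {v \<in> discordant_vertices E X. X v = c} \<le> card (colour_class X c)"
    by (rule card_mono) (auto simp: colour_class_def discordant_vertices_iff finite_verts)
  then show ?thesis
    using card_discordant_class[of X c] by linarith
qed

lemma card_isolated_le: "2 * card (isolated X c) \<le> card (discordant_edges E X)"
proof -
  have "card (isolated X c) \<le> card {v \<in> discordant_vertices E X. X v = c}"
    by (rule card_mono) (auto simp: isolated_def discordant_vertices_iff)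
  then show ?thesis
    using card_discordant_class[of X c] by linarith
qed

lemma card_colour_classes: "card (colour_class X Red) + card (colour_class X Blue) = card V"
proof -
  have "card (colour_class X Red \<union> colour_class X Blue) =
      card (colour_class X Red) + card (colour_class X Blue)"
    by (rule card_Un_disjoint) (auto simp: colour_class_def finite_verts)
  moreover have "colour_class X Red \<union> colour_class X Blue = V"
    using colour.exhaust by (auto simp: colour_class_def)
  ultimately show ?thesis by simp
qed

text \<open>Edges away from \<open>v\<close> keep their status and both edges at \<open>v\<close>
  change it, so a discordant degree \<open>d\<close> at \<open>v\<close> becomes
  \<open>2 - d\<close>.\<close>

lemma card_discordant_edges_flip:
  assumes "v \<in> V"
  shows "card (discordant_edges E (flip X v)) + 2 * discordant_degree X v =
    card (discordant_edges E X) + 2"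
proof -
  let ?N = "{u. {u, v} \<in> E}" and ?rest = "{e \<in> discordant_edges E X. v \<notin> e}"
  \<comment> \<open>Stated for every \<open>Y\<close> that agrees with \<open>X\<close> off
    \<open>v\<close>, so that it applies both to \<open>X\<close> and to the flipped configuration
    with the same \<open>?rest\<close>.\<close>
  have split: "card (discordant_edges E Y) = card ?rest + discordant_degree Y v"
    if "\<And>u. u \<noteq> v \<Longrightarrow> Y u = X u" for Y
  proof -
    have "discordant_edges E Y = ?rest \<union> (\<lambda>u. {u, v}) ` discordant_neighbours E Y v"
    proof (intro equalityI subsetI)
      fix e assume e: "e \<in> discordant_edges E Y"
      then obtain a b where ab: "e = {a, b}" "a \<in> discordant_neighbours E Y b"
        by (rule discordant_edge_cases[where c = Red])
      show "e \<in> ?rest \<union> (\<lambda>u. {u, v}) ` discordant_neighbours E Y v"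
      proof (cases "v \<in> e")
        case True
        then show ?thesis
          using ab discordant_neighbours_sym[of a Y b] by (auto simp: insert_commute)
      next
        case False
        then have "a \<in> discordant_neighbours E X b"
          using ab that[of a] that[of b] by (auto simp: discordant_neighbours_def)
        then show ?thesis
          using False ab doubleton_discordant_iff[of a b X] by simp
      qed
    next
      fix e assume "e \<in> ?rest \<union> (\<lambda>u. {u, v}) ` discordant_neighbours E Y v"
      then show "e \<in> discordant_edges E Y"
      proof
        assume e: "e \<in> ?rest"
        then have "e \<in> discordant_edges E X"
          by simp
        then obtain a b where ab: "e = {a, b}" "a \<in> discordant_neighbours E X b"
          by (rule discordant_edge_cases[where c = Red])
        then have "a \<in> discordant_neighbours E Y b"
          using e that[of a] that[of b] by (auto simp: discordant_neighbours_def)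
        then show ?thesis
          using ab doubleton_discordant_iff[of a b Y] by simp
      qed (auto simp: doubleton_discordant_iff)
    qed
    moreover have "card (?rest \<union> (\<lambda>u. {u, v}) ` discordant_neighbours E Y v) =
        card ?rest + card ((\<lambda>u. {u, v}) ` discordant_neighbours E Y v)"
      by (rule card_Un_disjoint) auto
    moreover have "card ((\<lambda>u. {u, v}) ` discordant_neighbours E Y v) = discordant_degree Y v"
      unfolding discordant_degree_def
      by (rule card_image) (auto simp: inj_on_def doubleton_eq_iff)
    ultimately show ?thesis
      by simp
  qed
  \<comment> \<open>With two colours, a neighbour of \<open>v\<close> disagrees with exactly one of
    the old and the new colour of \<open>v\<close>.\<close>
  have "?N = discordant_neighbours E X v \<union> discordant_neighbours E (flip X v) v"
    by (auto simp: discordant_neighbours_def colour_neq_iff[of _ "X v"] dest: edge_endpoints)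
  moreover have "card (discordant_neighbours E X v \<union> discordant_neighbours E (flip X v) v) =
      discordant_degree X v + discordant_degree (flip X v) v"
    unfolding discordant_degree_def
    by (intro card_Un_disjoint finite_discordant_neighbours)
      (auto simp: discordant_neighbours_def colour_neq_iff[of _ "X v"])
  ultimately have "discordant_degree X v + discordant_degree (flip X v) v = 2"
    using two_neighbours[OF assms] by simp
  then show ?thesis
    using split[of X] split[of "flip X v"] by simp
qed

lemma card_reds_flip:
  assumes "v \<in> V"
  shows "real (card (colour_class (flip X v) Red)) =
    real (card (colour_class X Red)) + (if X v = Red then - 1 else 1 :: real)"
proof (cases "X v")
  case Red
  then have "colour_class X Red = insert v (colour_class (flip X v) Red)"
    "v \<notin> colour_class (flip X v) Red"
    using assms by (auto simp: colour_class_def)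
  then show ?thesis
    using Red by (simp add: colour_class_def finite_verts)
next
  case Blue
  then have "colour_class (flip X v) Red = insert v (colour_class X Red)"
    "v \<notin> colour_class X Red"
    using assms by (auto simp: colour_class_def)
  then show ?thesis
    using Blue by (simp add: colour_class_def finite_verts)
qed

end

section \<open>One voting step\<close>

lemma measure_bind_pmf_of_set:
  assumes "finite A" "A \<noteq> {}" "\<And>x. x \<in> A \<Longrightarrow> finite (B x) \<and> B x \<noteq> {}"
  shows "measure (bind_pmf (pmf_of_set A) (\<lambda>x. pmf_of_set (B x))) S =
    (\<Sum>x\<in>A. real (card (B x \<inter> S)) / card (B x)) / card A"
proof -
  have "measure (bind_pmf (pmf_of_set A) (\<lambda>x. pmf_of_set (B x))) S =
      measure_pmf.expectation (bind_pmf (pmf_of_set A) (\<lambda>x. pmf_of_set (B x))) (indicator S)"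
    by simp
  also have "\<dots> = (\<Sum>x\<in>A. measure_pmf.expectation (pmf_of_set (B x)) (indicator S) /\<^sub>R real (card A))"
    using assms by (intro pmf_expectation_bind_pmf_of_set) auto
  also have "\<dots> = (\<Sum>x\<in>A. real (card (B x \<inter> S)) / card (B x)) / card A"
    using assms by (simp add: measure_pmf_of_set sum_divide_distrib divide_inverse sum_distrib_left mult.commute)
  finally show ?thesis .
qed

context two_regular_graph
begin

lemma discordant_vertices_eq_empty_iff:
  "discordant_vertices E X = {} \<longleftrightarrow> discordant_edges E X = {}"
proof
  assume D: "discordant_vertices E X = {}"
  show "discordant_edges E X = {}"
  proof (rule ccontr)
    assume "discordant_edges E X \<noteq> {}"
    then obtain e where e: "e \<in> discordant_edges E X"
      by blast
    then obtain u v where "e = {u, v}"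
      by (rule discordant_edge_cases[where c = Red])
    with e have "u \<in> discordant_vertices E X"
      by (auto simp: discordant_vertices_def)
    with D show False by simp
  qed
qed (simp add: discordant_vertices_def)

lemma card_discordant_class_real:
  "real (card {v \<in> discordant_vertices E X. X v = c}) =
     real (card (discordant_edges E X)) - card (isolated X c)"
  using card_discordant_class[of X c] by linarith

lemma card_isolated_pair:
  "card {v \<in> V. discordant_degree X v = 2} = card (isolated X Red) + card (isolated X Blue)"
proof -
  have "{v \<in> V. discordant_degree X v = 2} = isolated X Red \<union> isolated X Blue"
    using colour.exhaust by (auto simp: isolated_def)
  moreover have "card (isolated X Red \<union> isolated X Blue) =
      card (isolated X Red) + card (isolated X Blue)"
    by (rule card_Un_disjoint) (auto simp: isolated_def)
  ultimately show ?thesis by simp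
qed

text \<open>\<open>W\<close> is the law of the flipped vertex. Flipping a blue vertex adds a red
  one, so the difference of the two measures is the drift of the number of reds. The absolute values
  cover the opposite signs of this drift under Push and Pull.\<close>

definition flips_like :: "('v \<Rightarrow> colour) \<Rightarrow> real \<Rightarrow> 'v pmf \<Rightarrow> bool" where
  "flips_like X q W \<longleftrightarrow> 0 \<le> q \<and> set_pmf W \<subseteq> discordant_vertices E X \<and>
     \<bar>measure W {v. X v = Blue} - measure W {v. X v = Red}\<bar>
       \<le> q * \<bar>real (card (isolated X Red)) - card (isolated X Blue)\<bar> \<and>
     q * (real (card (isolated X Red)) + card (isolated X Blue))
       \<le> measure W {v. discordant_degree X v = 2}"

text \<open>The chosen vertex itself flips, whichever discordant neighbour is drawn, so the flipped
  vertex is uniform on \<open>D\<close>. All isolated vertices lie in \<open>D\<close>.\<close>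

lemma pull_kernel:
  assumes ne: "discordant_edges E X \<noteq> {}"
  defines "D \<equiv> discordant_vertices E X"
  shows "voting_kernel Pull E X = map_pmf (flip X) (pmf_of_set D)"
    and "flips_like X (1 / card D) (pmf_of_set D)"
proof -
  have D: "D \<noteq> {}" "finite D"
    using ne by (simp_all add: D_def discordant_vertices_eq_empty_iff)
  have "map_pmf (\<lambda>u. X(v := X u)) (pmf_of_set (discordant_neighbours E X v)) = return_pmf (flip X v)"
    if "v \<in> D" for v
  proof -
    have "discordant_neighbours E X v \<noteq> {}"
      using that by (auto simp: D_def discordant_vertices_iff discordant_degree_def)
    then have "map_pmf (\<lambda>u. X(v := X u)) (pmf_of_set (discordant_neighbours E X v)) =
        map_pmf (\<lambda>_. flip X v) (pmf_of_set (discordant_neighbours E X v))"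
      by (intro map_pmf_cong refl)
        (simp add: set_pmf_of_set, simp add: discordant_neighbours_def colour_neq_iff[of _ "X v"])
    then show ?thesis by simp
  qed
  then have "update Pull E X = map_pmf (flip X) (pmf_of_set D)"
    using D unfolding map_pmf_def[of "flip X"] update.simps D_def[symmetric]
    by (intro bind_pmf_cong) auto
  then show "voting_kernel Pull E X = map_pmf (flip X) (pmf_of_set D)"
    using ne by (simp add: voting_kernel_def)
  have col: "measure (pmf_of_set D) {v. X v = c} =
      (real (card (discordant_edges E X)) - card (isolated X c)) / card D" for c
  proof -
    have "D \<inter> {v. X v = c} = {v \<in> discordant_vertices E X. X v = c}"
      by (auto simp: D_def)
    then show ?thesis
      using D card_discordant_class_real[of X c] by (simp add: measure_pmf_of_set)
  qed
  have "measure (pmf_of_set D) {v. discordant_degree X v = 2} =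
      (real (card (isolated X Red)) + card (isolated X Blue)) / card D"
  proof -
    have "D \<inter> {v. discordant_degree X v = 2} = {v \<in> V. discordant_degree X v = 2}"
      by (auto simp: D_def discordant_vertices_iff)
    then show ?thesis
      using D card_isolated_pair[of X] by (simp add: measure_pmf_of_set)
  qed
  then show "flips_like X (1 / card D) (pmf_of_set D)"
    unfolding flips_like_def col diff_divide_distrib[symmetric]
    using D by (simp add: D_def)
qed

text \<open>The flipped vertex has the colour opposite to the chosen one, so the two colours swap
  roles compared with Pull. An isolated vertex can be reached from both neighbours, each of which
  selects it with conditional probability at least 1/2.\<close>

lemma push_kernel:
  assumes ne: "discordant_edges E X \<noteq> {}"
  defines "D \<equiv> discordant_vertices E X"
  defines "W \<equiv> bind_pmf (pmf_of_set D) (\<lambda>v. pmf_of_set (discordant_neighbours E X v))"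
  shows "voting_kernel Push E X = map_pmf (flip X) W" and "flips_like X (1 / card D) W"
proof -
  let ?dn = "discordant_neighbours E X"
  have D: "D \<noteq> {}" "finite D"
    using ne by (simp_all add: D_def discordant_vertices_eq_empty_iff)
  have dn: "finite (?dn v) \<and> ?dn v \<noteq> {}" if "v \<in> D" for v
    using that by (auto simp: D_def discordant_vertices_iff discordant_degree_def)
  have W: "measure W S = (\<Sum>v\<in>D. real (card (?dn v \<inter> S)) / card (?dn v)) / card D" for S
    unfolding W_def using D dn by (intro measure_bind_pmf_of_set) auto
  have "update Push E X = map_pmf (flip X) W"
    unfolding W_def map_bind_pmf update.simps D_def[symmetric]
  proof (intro bind_pmf_cong map_pmf_cong refl)
    fix v u assume "v \<in> set_pmf (pmf_of_set D)" "u \<in> set_pmf (pmf_of_set (?dn v))"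
    then show "X(u := X v) = flip X u"
      using D dn colour_neq_iff[of "X v" "X u"]
      by (auto simp: discordant_neighbours_def set_pmf_of_set)
  qed
  then show "voting_kernel Push E X = map_pmf (flip X) W"
    using ne by (simp add: voting_kernel_def)
  have sub: "set_pmf W \<subseteq> discordant_vertices E X"
  proof
    fix u assume "u \<in> set_pmf W"
    then obtain v where "v \<in> D" "u \<in> ?dn v"
      unfolding W_def using D dn by (auto simp: set_pmf_of_set)
    then have "v \<in> ?dn u" "u \<in> V"
      using discordant_neighbours_sym discordant_neighbours_subset by blast+
    then show "u \<in> discordant_vertices E X"
      by (auto simp: discordant_vertices_iff discordant_degree_def Suc_le_eq card_gt_0_iff)
  qed
  have col: "measure W {v. X v = c} =
      (real (card (discordant_edges E X)) - card (isolated X (opposite c))) / card D" for c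
  proof -
    have "(\<Sum>v\<in>D. real (card (?dn v \<inter> {u. X u = c})) / card (?dn v)) =
        (\<Sum>v\<in>D. of_bool (X v = opposite c))"
    proof (rule sum.cong[OF refl])
      fix v assume v: "v \<in> D"
      have "?dn v \<inter> {u. X u = c} = (if X v = opposite c then ?dn v else {})"
        by (cases c; cases "X v")
          (auto simp: discordant_neighbours_def colour_neq_iff[of "X _"])
      then show "real (card (?dn v \<inter> {u. X u = c})) / card (?dn v) = of_bool (X v = opposite c)"
        using dn[OF v] by simp
    qed
    also have "\<dots> = real (card {v \<in> D. X v = opposite c})"
      using D by (simp add: sum.If_cases of_bool_def Int_def)
    finally show ?thesis
      unfolding W using card_discordant_class_real[of X "opposite c"] by (simp add: D_def)
  qed
  have "(real (card (isolated X Red)) + card (isolated X Blue)) =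
      (\<Sum>u\<in>{u \<in> V. discordant_degree X u = 2}. real (card (?dn u)) / 2)"
    unfolding discordant_degree_def[symmetric] using card_isolated_pair[of X] by simp
  \<comment> \<open>The weight 1 of an isolated vertex is split into 1/2 for each of its two
    discordant neighbours, to be collected at those neighbours by exchanging the sums.\<close>
  also have "\<dots> = (\<Sum>u\<in>{u \<in> V. discordant_degree X u = 2}. \<Sum>v\<in>{v \<in> D. u \<in> ?dn v}. 1 / 2)"
  proof (intro sum.cong refl)
    fix u
    have "{v \<in> D. u \<in> ?dn v} = ?dn u"
      using sub discordant_neighbours_subset discordant_neighbours_sym
      by (fastforce simp: D_def discordant_vertices_iff discordant_degree_def Suc_le_eq card_gt_0_iff)
    then show "real (card (?dn u)) / 2 = (\<Sum>v\<in>{v \<in> D. u \<in> ?dn v}. 1 / 2)"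
      by simp
  qed
  also have "\<dots> = (\<Sum>v\<in>D. \<Sum>u\<in>{u. u \<in> {u \<in> V. discordant_degree X u = 2} \<and> u \<in> ?dn v}. 1 / 2)"
    using D by (intro sum.swap_restrict) auto
  also have "\<dots> \<le> (\<Sum>v\<in>D. real (card (?dn v \<inter> {u. discordant_degree X u = 2})) / card (?dn v))"
  proof (rule sum_mono)
    fix v assume v: "v \<in> D"
    have eq: "{u. u \<in> {u \<in> V. discordant_degree X u = 2} \<and> u \<in> ?dn v} =
        ?dn v \<inter> {u. discordant_degree X u = 2}"
      using discordant_neighbours_subset by blast
    have "0 < card (?dn v)" "card (?dn v) \<le> 2"
      using dn[OF v] v discordant_degree_le[of v X]
      by (auto simp: card_gt_0_iff D_def discordant_vertices_iff discordant_degree_def)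
    then show "(\<Sum>u\<in>{u. u \<in> {u \<in> V. discordant_degree X u = 2} \<and> u \<in> ?dn v}. 1 / 2)
        \<le> real (card (?dn v \<inter> {u. discordant_degree X u = 2})) / card (?dn v)"
      unfolding eq by (simp add: pos_le_divide_eq mult_left_mono)
  qed
  finally have "(real (card (isolated X Red)) + card (isolated X Blue)) / card D
      \<le> measure W {u. discordant_degree X u = 2}"
    unfolding W by (rule divide_right_mono) simp
  then show "flips_like X (1 / card D) W"
    using sub by (simp add: flips_like_def col flip: diff_divide_distrib) (simp add: abs_minus_commute)
qed

text \<open>A discordant edge has one endpoint of each colour and either is equally likely to flip.
  The drift is therefore zero, and \<open>q = 0\<close> suffices.\<close>

lemma oblivious_kernel:
  assumes ne: "discordant_edges E X \<noteq> {}"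
  defines "W \<equiv> bind_pmf (pmf_of_set (discordant_edges E X)) pmf_of_set"
  shows "voting_kernel Oblivious E X = map_pmf (flip X) W" and "flips_like X 0 W"
proof -
  let ?M = "discordant_edges E X"
  have edge: "finite e \<and> e \<noteq> {}" if "e \<in> ?M" for e
    using discordant_edge_cases[OF that, of Red] by (metis finite.emptyI finite.insertI insert_not_empty)
  have "update Oblivious E X = map_pmf (flip X) W"
    unfolding W_def map_bind_pmf update.simps
  proof (rule bind_pmf_cong[OF refl])
    fix e assume "e \<in> set_pmf (pmf_of_set ?M)"
    then have "e \<in> ?M"
      using ne by (simp add: set_pmf_of_set)
    then obtain u v where uv: "e = {u, v}" "u \<noteq> v" "X u = Red" "X v = opposite Red"
      by (rule discordant_edge_cases[where c = Red])
    \<comment> \<open>The rule draws the vertex whose colour survives, whereas \<open>flip\<close>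
      acts on the other endpoint. Exchanging the endpoints preserves the uniform law on
      \<open>e\<close>.\<close>
    let ?s = "\<lambda>w. if w = u then v else u"
    have "bij_betw ?s e e"
      unfolding bij_betw_def inj_on_def using uv by auto
    then have "pmf_of_set e = map_pmf ?s (pmf_of_set e)"
      using uv by (subst map_pmf_of_set_bij_betw) auto
    then have "map_pmf (flip X) (pmf_of_set e) = map_pmf (\<lambda>w. flip X (?s w)) (pmf_of_set e)"
      using pmf.map_comp[of "flip X" ?s "pmf_of_set e"] by (simp add: comp_def)
    also have "\<dots> = map_pmf (\<lambda>w x. if x \<in> e then X w else X x) (pmf_of_set e)"
      using uv by (intro map_pmf_cong refl) (auto simp: set_pmf_of_set fun_eq_iff)
    finally show "map_pmf (\<lambda>w x. if x \<in> e then X w else X x) (pmf_of_set e) =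
        map_pmf (flip X) (pmf_of_set e)" ..
  qed
  then show "voting_kernel Oblivious E X = map_pmf (flip X) W"
    using ne by (simp add: voting_kernel_def)
  have half_col: "measure W {v. X v = c} = 1 / 2" for c
  proof -
    have half: "real (card (e \<inter> {v. X v = c})) / card e = 1 / 2" if "e \<in> ?M" for e
      using that
    proof (rule discordant_edge_cases[where c = c])
      fix u v assume "e = {u, v}" "u \<noteq> v" "X u = c" "X v = opposite c"
      moreover from this have "e \<inter> {v. X v = c} = {u}"
        by auto
      ultimately show ?thesis by simp
    qed
    have "measure W {v. X v = c} = (\<Sum>e\<in>?M. real (card (e \<inter> {v. X v = c})) / card e) / card ?M"
      unfolding W_def using ne edge by (intro measure_bind_pmf_of_set) auto
    also have "\<dots> = (\<Sum>e\<in>?M. 1 / 2 :: real) / card ?M"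
      by (intro arg_cong2[where f = "(/)"] sum.cong half refl)
    finally show ?thesis
      using ne by (simp add: card_gt_0_iff)
  qed
  have "set_pmf W \<subseteq> discordant_vertices E X"
    unfolding W_def using ne edge by (auto simp: set_pmf_of_set discordant_vertices_def)
  then show "flips_like X 0 W"
    by (simp add: flips_like_def half_col)
qed

lemma voting_kernel_flips:
  assumes "discordant_edges E X \<noteq> {}"
  obtains q W where "voting_kernel p E X = map_pmf (flip X) W" "flips_like X q W"
  using pull_kernel[OF assms] push_kernel[OF assms] oblivious_kernel[OF assms]
  by (cases p) blast+

text \<open>Compensation of drift: \<open>a\<close> multiplies the change of the red count,
  \<open>b\<close> is the constant part of the increment and \<open>l\<close> the gain from flipping
  an isolated vertex. The unknown \<open>q\<close> scales both the drift bound and the isolation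
  bound, so it is absent from the condition on \<open>a\<close> and \<open>l\<close>.\<close>

lemma nn_integral_voting_kernel_le:
  fixes f :: "('v \<Rightarrow> colour) \<Rightarrow> real"
  assumes ne: "discordant_edges E X \<noteq> {}"
    and nonneg: "\<And>Y. 0 \<le> f Y"
    and le: "\<And>v. v \<in> discordant_vertices E X \<Longrightarrow> f (flip X v) \<le>
      f X + a * (if X v = Red then - 1 else 1) + b - l * of_bool (discordant_degree X v = 2)"
    and isolated: "\<bar>a\<bar> * \<bar>real (card (isolated X Red)) - card (isolated X Blue)\<bar>
      \<le> l * (real (card (isolated X Red)) + card (isolated X Blue))" and "0 \<le> l"
  shows "(\<integral>\<^sup>+Y. ennreal (f Y) \<partial>voting_kernel p E X) \<le> ennreal (f X + b)"
proof -
  obtain q W where W: "voting_kernel p E X = map_pmf (flip X) W" and q: "flips_like X q W"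
    using ne by (rule voting_kernel_flips)
  from q have sub: "set_pmf W \<subseteq> discordant_vertices E X"
    by (simp add: flips_like_def)
  have int: "integrable W h" for h :: "'v \<Rightarrow> real"
    by (rule integrable_measure_pmf_finite) (rule finite_subset[OF sub], simp)
  let ?red = "measure W {v. X v = Red}" and ?blue = "measure W {v. X v = Blue}"
    and ?iso = "measure W {v. discordant_degree X v = 2}"
  have sign: "(if X v = Red then - 1 else 1) =
      indicator {v. X v = Blue} v - (indicator {v. X v = Red} v :: real)" for v
    by (cases "X v") auto
  have "(\<integral>\<^sup>+Y. ennreal (f Y) \<partial>voting_kernel p E X) = ennreal (measure_pmf.expectation W (\<lambda>v. f (flip X v)))"
    unfolding W nn_integral_map_pmf
    by (rule nn_integral_eq_integral[OF int]) (simp add: nonneg)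
  also have "measure_pmf.expectation W (\<lambda>v. f (flip X v)) \<le>
      measure_pmf.expectation W (\<lambda>v. f X + b +
        a * (indicator {v. X v = Blue} v - indicator {v. X v = Red} v) -
        l * indicator {v. discordant_degree X v = 2} v)"
  proof (rule integral_mono_AE[OF int int], rule AE_pmfI)
    fix v assume "v \<in> set_pmf W"
    then have "v \<in> discordant_vertices E X"
      using sub by auto
    from le[OF this] show "f (flip X v) \<le> f X + b +
        a * (indicator {v. X v = Blue} v - indicator {v. X v = Red} v) -
        l * indicator {v. discordant_degree X v = 2} v"
      unfolding sign by (simp add: indicator_def of_bool_def)
  qed
  also have "\<dots> = f X + b + a * (?blue - ?red) - l * ?iso"
    by (simp add: int del: measure_pmf_zero_iff)
  also have "\<dots> \<le> f X + b"
  proof -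
    have "a * (?blue - ?red) \<le> \<bar>a\<bar> * \<bar>?blue - ?red\<bar>"
      by (metis abs_ge_self abs_mult)
    also have "\<dots> \<le> \<bar>a\<bar> * (q * \<bar>real (card (isolated X Red)) - card (isolated X Blue)\<bar>)"
      using q by (intro mult_left_mono) (auto simp: flips_like_def)
    also have "\<dots> \<le> q * (l * (real (card (isolated X Red)) + card (isolated X Blue)))"
      using mult_left_mono[OF isolated, of q] q by (simp add: flips_like_def mult.left_commute)
    also have "\<dots> \<le> l * ?iso"
      using q \<open>0 \<le> l\<close> mult_left_mono[of _ ?iso l] by (simp add: flips_like_def mult.left_commute)
    finally show ?thesis by simp
  qed
  finally show ?thesis
    by (simp add: ennreal_leI)
qed

end

section \<open>Potential functions\<close>

text \<open>The square near 0, continued by its tangents at \<open>m\<close> and \<open>- m\<close>.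
  The derivative stays within \<open>2 * m\<close>, which keeps the drift to be compensated
  small.\<close>

definition huber :: "real \<Rightarrow> real \<Rightarrow> real" where
  "huber m x = (if \<bar>x\<bar> \<le> m then x\<^sup>2 else 2 * m * \<bar>x\<bar> - m\<^sup>2)"

text \<open>The Huber function is the infimal convolution of the square with
  \<open>2 * m * \<bar>z\<bar>\<close>; this is the half saying that it lies below every
  competitor.\<close>

lemma huber_le:
  assumes "0 \<le> m"
  shows "huber m x \<le> (x - z)\<^sup>2 + 2 * m * \<bar>z\<bar>"
proof (cases "\<bar>x\<bar> \<le> m")
  case True
  have "x * z \<le> \<bar>x\<bar> * \<bar>z\<bar>"
    by (simp flip: abs_mult)
  also have "\<dots> \<le> m * \<bar>z\<bar>"
    using True by (intro mult_right_mono) auto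
  finally show ?thesis
    using True by (simp add: huber_def power2_diff)
next
  case False
  have "0 \<le> (\<bar>x - z\<bar> - m)\<^sup>2"
    by simp
  moreover have "m * \<bar>x\<bar> \<le> m * \<bar>x - z\<bar> + m * \<bar>z\<bar>"
    unfolding distrib_left[symmetric] using assms by (intro mult_left_mono) auto
  ultimately show ?thesis
    using False by (simp add: huber_def power2_diff algebra_simps)
qed

text \<open>The infimum at \<open>x\<close> is attained at \<open>z = x - c\<close>, where
  \<open>c\<close> is \<open>x\<close> clamped to the interval from \<open>- m\<close> to
  \<open>m\<close>. The same \<open>z\<close> is a competitor at \<open>x + h\<close>, which yields
  the tangent line with slope \<open>2 * c\<close> plus \<open>h^2\<close>.\<close>

lemma huber_add_le:
  assumes "0 \<le> m"
  shows "huber m (x + h) \<le> huber m x + 2 * max (- m) (min m x) * h + h\<^sup>2"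
proof -
  define c where "c = max (- m) (min m x)"
  have "huber m x = c\<^sup>2 + 2 * m * \<bar>x - c\<bar>"
    using assms by (auto simp: huber_def c_def power2_eq_square algebra_simps max_def min_def abs_if)
  moreover have "huber m (x + h) \<le> (x + h - (x - c))\<^sup>2 + 2 * m * \<bar>x - c\<bar>"
    by (rule huber_le[OF assms])
  ultimately show ?thesis
    unfolding c_def[symmetric] by (simp add: power2_sum mult.commute mult.left_commute)
qed

lemma huber_nonneg: "0 \<le> m \<Longrightarrow> 0 \<le> huber m x"
proof (cases "\<bar>x\<bar> \<le> m")
  case False
  assume "0 \<le> m"
  with False have "m * m \<le> m * \<bar>x\<bar>"
    by (intro mult_left_mono) auto
  moreover have "0 \<le> m * \<bar>x\<bar>"
    using \<open>0 \<le> m\<close> by simp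
  ultimately show ?thesis
    using False by (simp add: huber_def power2_eq_square)
qed (simp add: huber_def)

section \<open>Consensus time on connected 2-regular graphs\<close>

locale connected_two_regular_graph = two_regular_graph +
  assumes consensus_if_no_discordant: "\<And>X. discordant_edges E X = {} \<Longrightarrow> consensus V X"
begin

lemma consensus_iff: "consensus V X \<longleftrightarrow> discordant_edges E X = {}"
proof
  assume X: "consensus V X"
  show "discordant_edges E X = {}"
  proof (rule ccontr)
    assume "discordant_edges E X \<noteq> {}"
    then obtain e where "e \<in> discordant_edges E X"
      by blast
    then obtain u v where "u \<in> V" "v \<in> V" "X u = Red" "X v = opposite Red"
      by (rule discordant_edge_cases[where c = Red])
    moreover from this have "X u = X v"
      using X unfolding consensus_def by blast
    ultimately show False
      by simp
  qed
qed (rule consensus_if_no_discordant)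

lemma expected_consensus_time_eq:
  "expected_consensus_time p V E X =
    (\<Sum>t. \<integral>\<^sup>+\<omega>. indicator (- {Y. consensus V Y}) (\<omega> t) \<partial>markov_chain (voting_kernel p E) X)"
proof -
  have "expected_consensus_time p V E X =
      (\<integral>\<^sup>+\<omega>. ennreal_of_enat (INF t\<in>{t. \<omega> t \<in> {Y. consensus V Y}}. enat t)
        \<partial>markov_chain (voting_kernel p E) X)"
    by (simp add: expected_consensus_time_def consensus_time_def)
  also have "\<dots> = (\<Sum>t. \<integral>\<^sup>+\<omega>. indicator (- {Y. consensus V Y}) (\<omega> t) \<partial>markov_chain (voting_kernel p E) X)"
    by (rule expected_hitting_time_eq_suminf) (simp add: consensus_iff voting_kernel_def)
  finally show ?thesis .
qed

context
  fixes n reds discs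
  defines "n \<equiv> real (card V)"
    and "reds \<equiv> \<lambda>X. real (card (colour_class X Red))"
    and "discs \<equiv> \<lambda>X. real (card (discordant_edges E X))"
begin

lemma class_bounds:
  "discs X \<le> real (card (colour_class X c)) + real (card (isolated X c))"
  "2 * real (card (isolated X c)) \<le> discs X"
  using card_discordant_edges_le[of X c] card_isolated_le[of X c] by (simp_all add: discs_def)

lemma class_sizes:
  "real (card (colour_class X Red)) + real (card (colour_class X Blue)) = n"
  using card_colour_classes[of X] by (simp add: n_def)

lemma reds_bounds: "0 \<le> reds X" "reds X \<le> n"
  using class_sizes[of X] by (simp_all add: reds_def)

text \<open>Adding the class bounds for both colours gives 2 M \<le> n + \<open>s\<^sub>r\<close> +
  \<open>s\<^sub>b\<close> \<le> n + M.\<close>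

lemma discs_le: "discs X \<le> n"
  using class_bounds[of X Red] class_bounds[of X Blue] class_sizes[of X] by linarith

text \<open>A discordant vertex has discordant degree 1 or 2, so flipping it changes the number of
  discordant edges by 0 or -2.\<close>

lemma flip_step:
  assumes "v \<in> discordant_vertices E X"
  shows "reds (flip X v) = reds X + (if X v = Red then - 1 else 1)"
    and "discs (flip X v) = discs X - 2 * of_bool (discordant_degree X v = 2)"
proof -
  have v: "v \<in> V" "1 \<le> discordant_degree X v" "discordant_degree X v \<le> 2"
    using assms discordant_degree_le by (auto simp: discordant_vertices_iff)
  show "reds (flip X v) = reds X + (if X v = Red then - 1 else 1)"
    unfolding reds_def by (rule card_reds_flip[OF v(1)])
  show "discs (flip X v) = discs X - 2 * of_bool (discordant_degree X v = 2)"
    unfolding discs_def using card_discordant_edges_flip[OF v(1), of X] v(2,3) by auto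
qed

lemma expected_consensus_time_le:
  "expected_consensus_time p V E X\<^sub>0 \<le> ennreal (3 / 4 * n\<^sup>2)"
proof -
  \<comment> \<open>The first summand equals \<open>n^2 - (2 * reds X - n)^2\<close>.\<close>
  define f where "f X = 4 * reds X * (n - reds X) + 2 * n * discs X" for X
  have n0: "0 \<le> n"
    by (simp add: n_def)
  have nonneg: "0 \<le> f X" for X
    using reds_bounds[of X] n0 by (simp add: f_def discs_def)
  have drift: "(\<integral>\<^sup>+Y. ennreal (f Y) \<partial>voting_kernel p E X) + 4 \<le> ennreal (f X)"
    if "X \<notin> {Y. consensus V Y}" for X
  proof -
    have ne: "discordant_edges E X \<noteq> {}"
      using that by (simp add: consensus_iff)
    let ?a = "4 * (n - 2 * reds X)"
    \<comment> \<open>The -4 is the second-order term of the quadratic part. A flipped isolated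
      vertex lowers \<open>discs\<close> by 2, which is worth \<open>4 * n\<close> and dominates the
      slope \<open>?a\<close>.\<close>
    have "(\<integral>\<^sup>+Y. ennreal (f Y) \<partial>voting_kernel p E X) \<le> ennreal (f X + - 4)"
    proof (rule nn_integral_voting_kernel_le[OF ne nonneg, where a = ?a and l = "4 * n"])
      fix v assume v: "v \<in> discordant_vertices E X"
      define s :: real where "s = (if X v = Red then - 1 else 1)"
      have "s * s = 1"
        by (simp add: s_def)
      then have "4 * (reds X + s) * (n - (reds X + s)) = 4 * reds X * (n - reds X) + ?a * s - 4"
        by (simp add: algebra_simps)
      then show "f (flip X v) \<le> f X + ?a * (if X v = Red then - 1 else 1) + - 4 -
          4 * n * of_bool (discordant_degree X v = 2)"
        unfolding f_def flip_step[OF v] s_def[symmetric] by (simp add: right_diff_distrib)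
    next
      have "\<bar>?a\<bar> \<le> 4 * n"
        using reds_bounds[of X] by (simp add: abs_if)
      then show "\<bar>?a\<bar> * \<bar>real (card (isolated X Red)) - card (isolated X Blue)\<bar>
          \<le> 4 * n * (real (card (isolated X Red)) + card (isolated X Blue))"
        by (rule mult_mono) (auto simp: n0)
    qed (simp add: n0)
    \<comment> \<open>Needed because \<open>ennreal\<close> sends a negative
      \<open>f X + - 4\<close> to 0, and adding 4 would then overshoot \<open>f X\<close>.\<close>
    moreover have "4 \<le> f X"
    proof -
      have "1 \<le> discs X"
        using ne by (simp add: discs_def Suc_le_eq card_gt_0_iff)
      moreover have "2 \<le> n"
      proof -
        obtain e where "e \<in> discordant_edges E X"
          using ne by blast
        then obtain u v where "u \<in> V" "v \<in> V" "u \<noteq> v"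
          by (rule discordant_edge_cases[where c = Red])
        then have "card {u, v} \<le> card V"
          by (intro card_mono) auto
        with \<open>u \<noteq> v\<close> show ?thesis by (simp add: n_def)
      qed
      ultimately have "2 * 1 \<le> n * discs X"
        by (intro mult_mono) auto
      moreover have "0 \<le> reds X * (n - reds X)"
        using reds_bounds[of X] by simp
      ultimately show ?thesis
        by (simp add: f_def)
    qed
    ultimately have "(\<integral>\<^sup>+Y. ennreal (f Y) \<partial>voting_kernel p E X) + 4 \<le> ennreal (f X + - 4) + ennreal 4"
      by (simp add: add_right_mono)
    also have "\<dots> = ennreal (f X)"
      using \<open>4 \<le> f X\<close> by (subst ennreal_plus[symmetric]) auto
    finally show ?thesis .
  qed
  have "4 * expected_consensus_time p V E X\<^sub>0 \<le> ennreal (f X\<^sub>0)"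
    unfolding expected_consensus_time_eq
    by (rule suminf_alive_le[OF _ drift]) (simp_all add: consensus_iff voting_kernel_def)
  also have "f X\<^sub>0 \<le> 3 * n\<^sup>2"
  proof -
    have "0 \<le> (2 * reds X\<^sub>0 - n)\<^sup>2"
      by simp
    moreover have "n * discs X\<^sub>0 \<le> n * n"
      by (intro mult_left_mono discs_le n0)
    ultimately show ?thesis
      by (simp add: f_def power2_eq_square algebra_simps)
  qed
  finally have "4 * expected_consensus_time p V E X\<^sub>0 \<le> ennreal (3 * n\<^sup>2)"
    by (simp add: ennreal_leI)
  then show ?thesis
    by (cases "expected_consensus_time p V E X\<^sub>0")
      (auto simp: ennreal_mult[symmetric] ennreal_numeral[symmetric] top_unique ennreal_mult_top
        simp del: ennreal_numeral)
qed

text \<open>The potential must rise from at most \<open>14 * m^2\<close> to \<open>15 * m^2\<close>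
  at a rate of at most 4 per step. Hence the expected time is at least \<open>m^2 / 4\<close>, and
  \<open>m = n / 8\<close> gives the constant 1/256.\<close>

lemma expected_consensus_time_ge:
  assumes balanced: "2 * reds X\<^sub>0 = n"
  shows "ennreal (1 / 256 * n\<^sup>2) \<le> expected_consensus_time p V E X\<^sub>0"
proof -
  define m where "m = n / 8"
  define f where "f X = huber m (2 * reds X - n) + 2 * m * min (discs X) (discs X / 2 + 3 * m)" for X
  have m0: "0 \<le> m"
    by (simp add: m_def n_def)
  have nonneg: "0 \<le> f X" for X
    using m0 huber_nonneg[OF m0, of "2 * reds X - n"] by (simp add: f_def discs_def)
  have drift: "(\<integral>\<^sup>+Y. ennreal (f Y) \<partial>voting_kernel p E X) \<le> ennreal (f X) + 4"
    if "X \<notin> {Y. consensus V Y}" for X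
  proof -
    have ne: "discordant_edges E X \<noteq> {}"
      using that by (simp add: consensus_iff)
    \<comment> \<open>Half the derivative of the Huber function at the current imbalance.\<close>
    define c where "c = max (- m) (min m (2 * reds X - n))"
    \<comment> \<open>The loss of potential when \<open>discs\<close> falls by 2: the slope in
      \<open>discs\<close> is \<open>2 * m\<close> up to \<open>6 * m\<close> and \<open>m\<close>
      beyond.\<close>
    define l where "l = (if discs X \<le> 6 * m then 4 * m else 2 * m)"
    have c: "\<bar>c\<bar> \<le> m"
      using m0 by (auto simp: c_def)
    have "(\<integral>\<^sup>+Y. ennreal (f Y) \<partial>voting_kernel p E X) \<le> ennreal (f X + 4)"
    proof (rule nn_integral_voting_kernel_le[OF ne nonneg, where a = "4 * c" and l = l])
      fix v assume v: "v \<in> discordant_vertices E X"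
      define s :: real where "s = (if X v = Red then - 1 else 1)"
      define d :: real where "d = of_bool (discordant_degree X v = 2)"
      have step: "reds (flip X v) = reds X + s" "discs (flip X v) = discs X - 2 * d"
        using flip_step[OF v] by (simp_all add: s_def d_def)
      have "s\<^sup>2 = 1"
        by (simp add: s_def)
      then have "huber m (2 * reds X - n + 2 * s) \<le> huber m (2 * reds X - n) + 4 * c * s + 4"
        using huber_add_le[OF m0, of "2 * reds X - n" "2 * s", folded c_def]
        by (simp add: power_mult_distrib)
      \<comment> \<open>Since the minimum lies below both branches, the branch active at
        \<open>X\<close> bounds the new value even if the step crosses the kink.\<close>
      moreover have "2 * m * min (discs X - 2 * d) ((discs X - 2 * d) / 2 + 3 * m) \<le>
          2 * m * min (discs X) (discs X / 2 + 3 * m) - l * d"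
      proof (cases "discs X \<le> 6 * m")
        case True
        have "2 * m * min (discs X - 2 * d) ((discs X - 2 * d) / 2 + 3 * m) \<le> 2 * m * (discs X - 2 * d)"
          using m0 by (intro mult_left_mono) auto
        moreover have "min (discs X) (discs X / 2 + 3 * m) = discs X"
          using True by simp
        ultimately show ?thesis
          using True by (simp add: l_def right_diff_distrib)
      next
        case False
        have "2 * m * min (discs X - 2 * d) ((discs X - 2 * d) / 2 + 3 * m) \<le>
            2 * m * ((discs X - 2 * d) / 2 + 3 * m)"
          using m0 by (intro mult_left_mono) auto
        moreover have "min (discs X) (discs X / 2 + 3 * m) = discs X / 2 + 3 * m"
          using False by simp
        ultimately show ?thesis
          using False by (simp add: l_def diff_divide_distrib right_diff_distrib distrib_left)
      qed
      ultimately show "f (flip X v) \<le> f X + 4 * c * (if X v = Red then - 1 else 1) + 4 -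
          l * of_bool (discordant_degree X v = 2)"
        unfolding s_def[symmetric] d_def[symmetric] f_def step by (simp add: algebra_simps)
    next
      let ?r = "real (card (isolated X Red))" and ?b = "real (card (isolated X Blue))"
      have "4 * m * \<bar>?r - ?b\<bar> \<le> l * (?r + ?b)"
      proof (cases "discs X \<le> 6 * m")
        case True
        then show ?thesis
          using m0 by (simp add: l_def mult_left_mono)
      next
        case False
        have "6 * m < discs X"
          using False by simp
        \<comment> \<open>Writing M for \<open>discs X\<close>, the class bounds give 2 M \<le> 8 m
          + r + b and r \<le> M/2. Hence b \<ge> 3 M/2 - 8 m, which exceeds M/6 \<ge> r/3 once M > 6
          m; the other inequality is symmetric.\<close>
        then have "?r \<le> 3 * ?b" "?b \<le> 3 * ?r"
          using class_bounds[of X Red] class_bounds[of X Blue] class_sizes[of X]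
          unfolding m_def by linarith+
        then have "2 * \<bar>?r - ?b\<bar> \<le> ?r + ?b"
          by (simp add: abs_if)
        from mult_left_mono[OF this, of "2 * m"] show ?thesis
          using m0 False by (simp add: l_def)
      qed
      moreover have "\<bar>4 * c\<bar> * \<bar>?r - ?b\<bar> \<le> 4 * m * \<bar>?r - ?b\<bar>"
        using c by (intro mult_right_mono) auto
      ultimately show "\<bar>4 * c\<bar> * \<bar>?r - ?b\<bar> \<le> l * (?r + ?b)"
        by linarith
    qed (simp add: l_def m0)
    then show ?thesis
      using nonneg[of X] by (simp add: ennreal_plus)
  qed
  have target: "ennreal (15 * m\<^sup>2) \<le> ennreal (f X)" if "X \<in> {Y. consensus V Y}" for X
  proof -
    have "(\<forall>v\<in>V. X v \<noteq> Red) \<or> (\<forall>v\<in>V. X v = Red)"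
      using that unfolding consensus_def mem_Collect_eq by metis
    then have "colour_class X Red = {} \<or> colour_class X Red = V"
      by (auto simp: colour_class_def)
    then have "\<bar>2 * reds X - n\<bar> = 8 * m"
      by (auto simp: reds_def m_def n_def)
    \<comment> \<open>The imbalance \<open>8 * m\<close> lies on the linear part, with value
      \<open>16 * m^2 - m^2\<close>.\<close>
    then have "huber m (2 * reds X - n) = 15 * m\<^sup>2"
      using m0 by (auto simp: huber_def power2_eq_square)
    then show ?thesis
      using m0 by (simp add: f_def discs_def ennreal_leI)
  qed
  have "ennreal (15 * m\<^sup>2) \<le> ennreal (f X\<^sub>0) + 4 * expected_consensus_time p V E X\<^sub>0"
    unfolding expected_consensus_time_eq
  proof (rule suminf_alive_ge[OF _ drift target])
    \<comment> \<open>The upper bound supplies the finiteness that the lower drift argument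
      requires.\<close>
    show "(\<Sum>t. \<integral>\<^sup>+\<omega>. indicator (- {Y. consensus V Y}) (\<omega> t) \<partial>markov_chain (voting_kernel p E) X\<^sub>0) \<noteq> top"
      using expected_consensus_time_le[of p X\<^sub>0] unfolding expected_consensus_time_eq
      by (auto simp: top_unique)
  qed (simp_all add: consensus_iff voting_kernel_def)
  also have "f X\<^sub>0 \<le> 14 * m\<^sup>2"
  proof -
    \<comment> \<open>The Huber part vanishes for a balanced start. Since
      \<open>discs X\<^sub>0 \<le> n = 8 * m\<close>, the second branch of the minimum is at most
      \<open>4 * m + 3 * m\<close>.\<close>
    have "2 * m * min (discs X\<^sub>0) (discs X\<^sub>0 / 2 + 3 * m) \<le> 2 * m * (7 * m)"
      using discs_le[of X\<^sub>0] m0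
      by (intro mult_left_mono order_trans[OF min.cobounded2]) (simp_all add: m_def)
    then show ?thesis
      using balanced m0 by (simp add: f_def huber_def power2_eq_square)
  qed
  finally have le: "ennreal (15 * m\<^sup>2) \<le> ennreal (14 * m\<^sup>2) + 4 * expected_consensus_time p V E X\<^sub>0"
    by (simp add: ennreal_leI add_right_mono)
  show ?thesis
  proof (cases "expected_consensus_time p V E X\<^sub>0")
    case (real t)
    then have "ennreal (15 * m\<^sup>2) \<le> ennreal (14 * m\<^sup>2 + 4 * t)"
      using le by (simp add: ennreal_plus ennreal_mult)
    then have "15 * m\<^sup>2 \<le> 14 * m\<^sup>2 + 4 * t"
      using real(1) by (subst (asm) ennreal_le_iff) simp_all
    then show ?thesis
      using real by (simp add: m_def power2_eq_square ennreal_leI)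
  qed simp
qed

end
end

section \<open>The cycle as a connected 2-regular graph\<close>

lemma cycle_edge_iff:
  "{u, v} \<in> cycle_edges n \<longleftrightarrow> u < n \<and> v < n \<and> (u = Suc v mod n \<or> v = Suc u mod n)"
proof -
  have "{u, v} \<in> cycle_edges n \<longleftrightarrow>
      (\<exists>i<n. u = i \<and> v = Suc i mod n \<or> u = Suc i mod n \<and> v = i)"
    by (simp add: cycle_edges_def image_iff doubleton_eq_iff Bex_def)
  also have "\<dots> \<longleftrightarrow> u < n \<and> v < n \<and> (u = Suc v mod n \<or> v = Suc u mod n)"
    by (cases "n = 0") auto
  finally show ?thesis .
qed

lemma cycle_graph:
  assumes "3 \<le> n"
  shows "connected_two_regular_graph (cycle_verts n) (cycle_edges n)"
proof
  show "finite (cycle_verts n)"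
    by (simp add: cycle_verts_def)
  show "\<exists>u\<in>cycle_verts n. \<exists>v\<in>cycle_verts n. u \<noteq> v \<and> e = {u, v}" if e: "e \<in> cycle_edges n" for e
  proof -
    obtain i where i: "e = {i, Suc i mod n}" "i < n"
      using e by (auto simp: cycle_edges_def)
    then have "i \<noteq> Suc i mod n" "Suc i mod n < n"
      using assms by (simp_all add: mod_Suc)
    with i show ?thesis
      unfolding cycle_verts_def by (intro bexI[of _ i] bexI[of _ "Suc i mod n"]) simp_all
  qed
  show "card {u. {u, v} \<in> cycle_edges n} = 2" if v: "v \<in> cycle_verts n" for v
  proof -
    \<comment> \<open>Predecessor and successor are written without \<open>mod\<close>, so that
      membership reduces to linear case distinctions.\<close>
    let ?pred = "if v = 0 then n - 1 else v - 1" and ?succ = "if Suc v = n then 0 else Suc v"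
    have Suc_mod: "Suc w mod n = (if Suc w = n then 0 else Suc w)" if "w < n" for w
      using that by (simp add: mod_Suc)
    have v': "v < n"
      using v by (simp add: cycle_verts_def)
    have nbr: "u < n \<and> (u = Suc v mod n \<or> v = Suc u mod n) \<longleftrightarrow> u = ?pred \<or> u = ?succ" for u
    proof (cases "u < n")
      case True
      show ?thesis
        unfolding Suc_mod[OF v'] Suc_mod[OF True] using True v' assms
        by (cases "Suc u = n"; cases "Suc v = n"; cases "v = 0"; cases "u = 0"; simp; arith)
    next
      case False
      then show ?thesis
        using v' assms by (cases "v = 0"; cases "Suc v = n"; simp)
    qed
    have "{u. {u, v} \<in> cycle_edges n} = {u. u = ?pred \<or> u = ?succ}"
      unfolding cycle_edge_iff nbr[symmetric] using v' by blast
    also have "\<dots> = {?pred, ?succ}"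
      by (rule set_eqI) (simp only: mem_Collect_eq insert_iff empty_iff simp_thms)
    finally have "{u. {u, v} \<in> cycle_edges n} = {?pred, ?succ}" .
    \<comment> \<open>The bound \<open>3 \<le> n\<close> matters here: for \<open>n = 2\<close> both
      would be the same vertex.\<close>
    moreover have "?pred \<noteq> ?succ"
      using v assms by (auto simp: cycle_verts_def)
    ultimately show ?thesis
      by simp
  qed
  show "consensus (cycle_verts n) X" if none: "discordant_edges (cycle_edges n) X = {}" for X
  proof -
    \<comment> \<open>The edges along the path from 0 to \<open>n - 1\<close> already propagate the
      colour of 0.\<close>
    have const: "X i = X 0" if "i < n" for i
      using that
    proof (induction i)
      case (Suc i)
      have "{i, Suc i} \<in> cycle_edges n"
        using Suc.prems by (simp add: cycle_edge_iff)
      then have "X i = X (Suc i)"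
        using none unfolding discordant_edges_def by blast
      with Suc show ?case
        by simp
    qed simp
    show ?thesis
      unfolding consensus_def cycle_verts_def
      by (intro ballI trans[OF const const[symmetric]]) simp_all
  qed
qed

theorem theorem2:
  fixes p :: protocol
  shows "\<exists>c>0. \<exists>C>0. \<forall>\<^sub>F n in sequentially. even n \<longrightarrow>
    (\<forall>X\<^sub>0. card {v \<in> cycle_verts n. X\<^sub>0 v = Red} = n div 2 \<and>
          card {v \<in> cycle_verts n. X\<^sub>0 v = Blue} = n div 2 \<longrightarrow>
       ennreal (c * real n ^ 2)
         \<le> expected_consensus_time p (cycle_verts n) (cycle_edges n) X\<^sub>0 \<and>
       expected_consensus_time p (cycle_verts n) (cycle_edges n) X\<^sub>0
         \<le> ennreal (C * real n ^ 2))"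
proof (rule exI[of _ "1 / 256"], rule conjI, simp, rule exI[of _ "3 / 4"], rule conjI, simp,
    rule eventually_sequentiallyI[of 3], intro impI allI, elim conjE)
  fix n :: nat and X\<^sub>0 :: "nat \<Rightarrow> colour"
  assume n: "3 \<le> n" "even n" and red: "card {v \<in> cycle_verts n. X\<^sub>0 v = Red} = n div 2"
  interpret connected_two_regular_graph "cycle_verts n" "cycle_edges n"
    by (rule cycle_graph[OF n(1)])
  \<comment> \<open>Evenness of \<open>n\<close> makes \<open>n div 2\<close> exactly half of the
    vertices, so the initial imbalance is 0.\<close>
  have "2 * real (card (colour_class X\<^sub>0 Red)) = real (card (cycle_verts n))"
    unfolding colour_class_def red using n(2) by (simp add: cycle_verts_def real_of_nat_div)
  from expected_consensus_time_ge[OF this, of p] expected_consensus_time_le[of p X\<^sub>0]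
  show "ennreal (1 / 256 * real n ^ 2) \<le> expected_consensus_time p (cycle_verts n) (cycle_edges n) X\<^sub>0 \<and>
      expected_consensus_time p (cycle_verts n) (cycle_edges n) X\<^sub>0 \<le> ennreal (3 / 4 * real n ^ 2)"
    by (simp add: cycle_verts_def)
qed

end
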